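(* Let $\ell>0$, $\overline p>0$. For every entropy profile $s\in\mathcal P$ and every $k\in\mathbb N$, the linearized system $$P_x+U_t=0,\qquad U_x+\sigma^2(x)P_t=0,\qquad 0\le x\le\ell,$$ with the boundary conditions (BC) admits a $k$-mode solution $$P(x,t)=\cos(\omega_kt)\,\varphi_k(x),\qquad U(x,t)=\sin(\omega_kt)\,\psi_k(x),$$ where $(\varphi_k,\psi_k)$ is a solution of the Sturm–Liouville system $\dot\varphi_k+\omega_k\psi_k=0$, $\dot\psi_k-\sigma^2\omega_k\varphi_k=0$ with corresponding eigenfrequency $\omega_k$. When combined with the boundary conditions (BC), this extends to a jointly periodic pure $k$-mode solution of the linearized system, with period $4\ell$ in $x$ and time period $T=2\pi k/\omega_k$.
   Context: $v=v(p,s)$ is a given smooth constitutive function with $v_p<0$; $\mathcal P$ is the set of piecewise $C^1$ functions $s:[0,\ell]\to\mathbb R$ (bounded, finitely many jumps, all interior); $\sigma(x)=\sqrt{-v_p(\overline p,s(x))}$. A dot denotes $d/dx$. Solutions are continuous (also across jumps of $\sigma$) and satisfy the equations almost everywhere. (BC), with $T=2\pi k/\omega_k$: $U(x,0)=U(x,T)$, $P(x,0)=P(x,T)$ for $x\in[0,\ell]$; $U(0,t)=0$ and $\frac{\mathcal I-\mathcal R}{2}\mathcal T^{-T/4}\big(P(\ell,\cdot)+U(\ell,\cdot)\big)(t)=0$ for $t\in[0,T]$, where $\mathcal If=f$, $\mathcal R[f](t)=f(-t)$, $\mathcal T^\tau[f](t)=f(t-\tau)$. The eigenfrequencies $0<\omega_1<\omega_2<\cdots$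 are labelled so that they are all the positive values of $\omega$ for which the solution of $\dot\varphi=-\omega\psi$, $\dot\psi=\omega\sigma^2\varphi$, $\varphi(0)=1$, $\psi(0)=0$ satisfies $\varphi(\ell)=0$ ($k$ odd) or $\psi(\ell)=0$ ($k$ even), in increasing order. In the extension to all $x\in\mathbb R$, the entropy $s$ is extended to be even and $2\ell$-periodic. *)

theory Defs
  imports "HOL-Analysis.Analysis"
begin

section \<open>Constitutive law, entropy profiles and the coefficient sigma\<close>

text \<open>
  \<open>C\<close>-infinity for functions of two real variables on an open set: \<open>D i j\<close> is the partial
  derivative of order \<open>i\<close> in the first and \<open>j\<close> in the second variable.
\<close>
definition smooth_two_on :: "(real \<times> real) set \<Rightarrow> (real \<Rightarrow> real \<Rightarrow> real) \<Rightarrow> bool" where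
  "smooth_two_on S f \<longleftrightarrow>
     (\<exists>D :: nat \<Rightarrow> nat \<Rightarrow> real \<times> real \<Rightarrow> real.
        (\<forall>(a, b) \<in> S. D 0 0 (a, b) = f a b) \<and>
        (\<forall>i j. \<forall>z \<in> S.
           (D i j has_derivative (\<lambda>(h, k). D (Suc i) j z * h + D i (Suc j) z * k)) (at z)))"

definition d_pressure :: "(real \<Rightarrow> real \<Rightarrow> real) \<Rightarrow> real \<Rightarrow> real \<Rightarrow> real" where
  "d_pressure v p s = deriv (\<lambda>q. v q s) p"

text \<open>The specific volume is a function of positive pressure and of arbitrary real entropy.\<close>
definition constitutive :: "(real \<Rightarrow> real \<Rightarrow> real) \<Rightarrow> bool" where
  "constitutive v \<longleftrightarrow>
     smooth_two_on ({0<..} \<times> UNIV) v \<and> (\<forall>p > 0. \<forall>s. d_pressure v p s < 0)"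

text \<open>
  Piecewise \<open>C\<close>-1 with possible jumps, all of them interior (the library notion
  \<open>piecewise_C1_differentiable_on\<close> requires continuity and hence does not apply).
  The one-sided limits of \<open>s\<close> and \<open>s'\<close> at the break points say that \<open>s\<close> is \<open>C\<close>-1 up to the
  boundary of each piece; the value of \<open>s\<close> at a break point is arbitrary.
\<close>
definition entropy_profile :: "real \<Rightarrow> (real \<Rightarrow> real) \<Rightarrow> bool" where
  "entropy_profile l s \<longleftrightarrow>
     bounded (s ` {0..l}) \<and>
     (\<exists>J s'. finite J \<and> J \<subseteq> {0<..<l} \<and>
        (\<forall>x \<in> {0..l} - J. (s has_real_derivative s' x) (at x within {0..l})) \<and>
        continuous_on ({0..l} - J) s' \<and>
        (\<forall>x \<in> J. (\<exists>a. (s \<longlongrightarrow> a) (at_left x)) \<and> (\<exists>a. (s \<longlongrightarrow> a) (at_right x)) \<and>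
                 (\<exists>a. (s' \<longlongrightarrow> a) (at_left x)) \<and> (\<exists>a. (s' \<longlongrightarrow> a) (at_right x))))"

definition sigma_coeff :: "(real \<Rightarrow> real \<Rightarrow> real) \<Rightarrow> real \<Rightarrow> (real \<Rightarrow> real) \<Rightarrow> real \<Rightarrow> real" where
  "sigma_coeff v pbar s x = sqrt (- d_pressure v pbar (s x))"

text \<open>
  The even \<open>2l\<close>-periodic extension of a profile on \<open>[0, l]\<close>: \<open>x\<close> is translated into \<open>[-l, l]\<close> by a
  multiple of \<open>2l\<close> and then reflected into \<open>[0, l]\<close>.
\<close>
definition even_periodic_ext :: "real \<Rightarrow> (real \<Rightarrow> real) \<Rightarrow> real \<Rightarrow> real" where
  "even_periodic_ext l s x = s \<bar>x - 2 * l * of_int (round (x / (2 * l)))\<bar>"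

section \<open>The linearized system and its boundary conditions\<close>

text \<open>
  Solutions are continuous and satisfy the equations at every point of the interval \<open>S\<close> at which
  \<open>\<sigma>\<close> is continuous. For a piecewise \<open>C\<close>-1 profile this excludes only the finitely many jumps of
  \<open>\<sigma>\<close> (locally finitely many, for the periodic extension), so the equations hold almost everywhere;
  see \<open>finite_discontinuities_sigma\<close> below.
  Allowing an arbitrary null set for merely continuous functions would instead admit
  Cantor-type functions, for which the initial value problem is not uniquely solvable.
  Derivatives at end points of \<open>S\<close> are one-sided.
\<close>
definition linear_solution ::
  "real set \<Rightarrow> (real \<Rightarrow> real) \<Rightarrow> (real \<Rightarrow> real \<Rightarrow> real) \<Rightarrow> (real \<Rightarrow> real \<Rightarrow> real) \<Rightarrow> bool" where
  "linear_solution S \<sigma> P U \<longleftrightarrow>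
     continuous_on (S \<times> UNIV) (\<lambda>(x, t). P x t) \<and>
     continuous_on (S \<times> UNIV) (\<lambda>(x, t). U x t) \<and>
     (\<forall>x \<in> S. \<forall>t. continuous (at x within S) \<sigma> \<longrightarrow>
        (\<exists>Px Pt Ux Ut.
           ((\<lambda>y. P y t) has_real_derivative Px) (at x within S) \<and>
           ((\<lambda>r. P x r) has_real_derivative Pt) (at t) \<and>
           ((\<lambda>y. U y t) has_real_derivative Ux) (at x within S) \<and>
           ((\<lambda>r. U x r) has_real_derivative Ut) (at t) \<and>
           Px + Ut = 0 \<and> Ux + (\<sigma> x)\<^sup>2 * Pt = 0))"

definition reflect :: "(real \<Rightarrow> real) \<Rightarrow> real \<Rightarrow> real" where
  "reflect f t = f (- t)"

definition translate :: "real \<Rightarrow> (real \<Rightarrow> real) \<Rightarrow> real \<Rightarrow> real" where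
  "translate \<tau> f t = f (t - \<tau>)"

definition odd_part :: "(real \<Rightarrow> real) \<Rightarrow> real \<Rightarrow> real" where
  "odd_part f t = (f t - reflect f t) / 2"

text \<open>
  The shift and the reflection evaluate the trace at \<open>x = l\<close> at times outside \<open>[0, T]\<close>; solutions
  are functions of all real times.
\<close>
definition boundary_conditions ::
  "real \<Rightarrow> real \<Rightarrow> (real \<Rightarrow> real \<Rightarrow> real) \<Rightarrow> (real \<Rightarrow> real \<Rightarrow> real) \<Rightarrow> bool" where
  "boundary_conditions l T P U \<longleftrightarrow>
     (\<forall>x \<in> {0..l}. U x 0 = U x T \<and> P x 0 = P x T) \<and>
     (\<forall>t \<in> {0..T}. U 0 t = 0 \<and>
        odd_part (translate (- T / 4) (\<lambda>r. P l r + U l r)) t = 0)"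

section \<open>The Sturm--Liouville system\<close>

definition sl_solution ::
  "real set \<Rightarrow> (real \<Rightarrow> real) \<Rightarrow> real \<Rightarrow> (real \<Rightarrow> real) \<Rightarrow> (real \<Rightarrow> real) \<Rightarrow> bool" where
  "sl_solution S \<sigma> w \<phi> \<psi> \<longleftrightarrow>
     continuous_on S \<phi> \<and> continuous_on S \<psi> \<and>
     (\<forall>x \<in> S. continuous (at x within S) \<sigma> \<longrightarrow>
        (\<exists>\<phi>' \<psi>'.
           (\<phi> has_real_derivative \<phi>') (at x within S) \<and>
           (\<psi> has_real_derivative \<psi>') (at x within S) \<and>
           \<phi>' + w * \<psi> x = 0 \<and> \<psi>' - (\<sigma> x)\<^sup>2 * w * \<phi> x = 0))"

definition sl_normalized ::
  "real \<Rightarrow> (real \<Rightarrow> real) \<Rightarrow> real \<Rightarrow> (real \<Rightarrow> real) \<Rightarrow> (real \<Rightarrow> real) \<Rightarrow> bool" where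
  "sl_normalized l \<sigma> w \<phi> \<psi> \<longleftrightarrow>
     sl_solution {0..l} \<sigma> w \<phi> \<psi> \<and> \<phi> 0 = 1 \<and> \<psi> 0 = 0"

text \<open>
  \<open>\<omega> 1 < \<omega> 2 < \<dots>\<close> is the list of all eigenfrequencies. These conditions determine \<open>\<omega> k\<close> for
  every \<open>k \<ge> 1\<close>; the value \<open>\<omega> 0\<close> is irrelevant.
\<close>
definition eigenfrequencies :: "real \<Rightarrow> (real \<Rightarrow> real) \<Rightarrow> (nat \<Rightarrow> real) \<Rightarrow> bool" where
  "eigenfrequencies l \<sigma> \<omega> \<longleftrightarrow>
     strict_mono_on {1..} \<omega> \<and>
     (\<forall>k \<ge> 1. 0 < \<omega> k \<and>
        (\<exists>\<phi> \<psi>. sl_normalized l \<sigma> (\<omega> k) \<phi> \<psi> \<and> (if odd k then \<phi> l = 0 else \<psi> l = 0))) \<and>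
     (\<forall>w > 0. \<forall>\<phi> \<psi>. sl_normalized l \<sigma> w \<phi> \<psi> \<and> (\<phi> l = 0 \<or> \<psi> l = 0) \<longrightarrow>
        (\<exists>k \<ge> 1. w = \<omega> k))"

definition mode_P :: "real \<Rightarrow> (real \<Rightarrow> real) \<Rightarrow> real \<Rightarrow> real \<Rightarrow> real" where
  "mode_P w \<phi> x t = cos (w * t) * \<phi> x"

definition mode_U :: "real \<Rightarrow> (real \<Rightarrow> real) \<Rightarrow> real \<Rightarrow> real \<Rightarrow> real" where
  "mode_U w \<psi> x t = sin (w * t) * \<psi> x"

definition jointly_periodic :: "real \<Rightarrow> real \<Rightarrow> (real \<Rightarrow> real \<Rightarrow> real) \<Rightarrow> bool" where
  "jointly_periodic X T f \<longleftrightarrow> (\<forall>x t. f (x + X) t = f x t \<and> f x (t + T) = f x t)"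

section \<open>Basic properties\<close>

lemma even_periodic_ext_eq:
  assumes "l > 0" "x \<in> {0..l}"
  shows "even_periodic_ext l s x = s x"
proof (cases "x = l")
  case True
  have "round (1 / 2 :: real) = 1" by (simp add: round_def)
  then show ?thesis using True assms by (simp add: even_periodic_ext_def)
next
  case False
  then have "round (x / (2 * l)) = 0"
    using assms unfolding round_def by (intro floor_unique) (auto simp: field_simps)
  then show ?thesis using assms by (simp add: even_periodic_ext_def)
qed

lemma even_periodic_ext_periodic:
  assumes "l > 0"
  shows "even_periodic_ext l s (x + 2 * l) = even_periodic_ext l s x"
proof -
  have "(x + 2 * l) / (2 * l) = x / (2 * l) + 1"
    using assms by (simp add: field_simps)
  then have "round ((x + 2 * l) / (2 * l)) = round (x / (2 * l)) + 1"
    unfolding round_def by linarith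
  then show ?thesis by (simp add: even_periodic_ext_def algebra_simps)
qed

lemma even_periodic_ext_even:
  assumes "l > 0"
  shows "even_periodic_ext l s (- x) = even_periodic_ext l s x"
proof -
  define y where "y = x / (2 * l)"
  have x: "x = 2 * l * y" using assms by (simp add: y_def)
  have "\<bar>- y - of_int (round (- y))\<bar> = \<bar>y - of_int (round y)\<bar>"
  proof -
    consider "round (- y) = - round y" | "\<bar>y - of_int (round y)\<bar> = 1 / 2"
    proof (cases "\<bar>y - of_int (round y)\<bar> = 1 / 2")
      case False
      then have "\<bar>- y - of_int (- round y)\<bar> < 1 / 2"
        using of_int_round_abs_le[of y] by (simp add: abs_if split: if_splits)
      then have "round (- y) = - round y" by (rule round_unique')
      then show ?thesis by (rule that(1))
    qed (use that in blast)
    then show ?thesis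
    proof cases
      case 1 then show ?thesis by simp
    next
      case 2
      have "round (- y) = - round y \<or> round (- y) = 1 - round y \<or> round (- y) = - 1 - round y"
        using 2 of_int_round_abs_le[of "- y"] by linarith
      moreover have "of_int (round y) = y - 1 / 2 \<or> of_int (round y) = y + 1 / 2"
        using 2 by linarith
      ultimately show ?thesis using of_int_round_abs_le[of "- y"] by auto
    qed
  qed
  then have "\<bar>2 * l * (- y - of_int (round (- y)))\<bar> = \<bar>2 * l * (y - of_int (round y))\<bar>"
    unfolding abs_mult by simp
  then show ?thesis using assms
    by (simp add: even_periodic_ext_def x right_diff_distrib)
qed

lemma finite_discontinuities_sigma:
  assumes "pbar > 0" "constitutive v" "entropy_profile l s"
  shows "finite {x \<in> {0..l}. \<not> continuous (at x within {0..l}) (sigma_coeff v pbar s)}"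
proof -
  obtain D where D0': "\<forall>(a, b) \<in> {0<..} \<times> UNIV. D 0 0 (a, b) = v a b"
    and D': "\<forall>i j. \<forall>z \<in> {0<..} \<times> UNIV.
      (D i j has_derivative (\<lambda>(h, k). D (Suc i) j z * h + D i (Suc j) z * k)) (at z)"
    using assms(2) unfolding constitutive_def smooth_two_on_def by (elim conjE exE)
  have D0: "D 0 0 (a, b) = v a b" if "a > 0" for a b
    using bspec[OF D0', of "(a, b)"] that by simp
  have D: "(D i j has_derivative (\<lambda>(h, k). D (Suc i) j z * h + D i (Suc j) z * k)) (at z)"
    if "z \<in> {0<..} \<times> UNIV" for i j z
    by (rule D'[rule_format, OF that])
  have vp: "d_pressure v pbar b = D 1 0 (pbar, b)" for b
  proof -
    have pair: "((\<lambda>q. (q, b)) has_derivative (\<lambda>h. (h, 0))) (at pbar)"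
      by (auto intro!: derivative_eq_intros)
    have d: "(D 0 0 has_derivative (\<lambda>(h, k). D 1 0 (pbar, b) * h + D 0 1 (pbar, b) * k))
        (at (pbar, b))"
      using D[of "(pbar, b)" 0 0] assms(1) by simp
    have "((\<lambda>q. D 0 0 (q, b)) has_real_derivative D 1 0 (pbar, b)) (at pbar)"
      using has_derivative_compose[OF pair d] by (simp add: has_field_derivative_def)
    then have "((\<lambda>q. v q b) has_real_derivative D 1 0 (pbar, b)) (at pbar)"
      by (rule has_field_derivative_transform_within_open[where S = "{0<..}"])
         (auto simp: assms(1) D0)
    then show ?thesis by (simp add: d_pressure_def DERIV_imp_deriv)
  qed
  obtain J s' where J: "finite J"
    and s': "\<And>x. x \<in> {0..l} - J \<Longrightarrow> (s has_real_derivative s' x) (at x within {0..l})"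
    using assms(3) unfolding entropy_profile_def by blast
  have "continuous (at x within {0..l}) (sigma_coeff v pbar s)" if "x \<in> {0..l} - J" for x
  proof -
    have "continuous (at x within {0..l}) s"
      using s'[OF that] DERIV_continuous by blast
    moreover have "isCont (D 1 0) (pbar, s x)"
      using D[of "(pbar, s x)" 1 0] assms(1) has_derivative_continuous by auto
    moreover have "continuous (at x within {0..l}) (\<lambda>x. (pbar, s x))"
      using calculation(1) by (rule continuous_Pair[OF continuous_const])
    ultimately have "continuous (at x within {0..l}) (\<lambda>x. D 1 0 (pbar, s x))"
      by (metis continuous_within_compose3)
    then show ?thesis
      unfolding sigma_coeff_def[abs_def] vp by (intro continuous_intros)
  qed
  then have "{x \<in> {0..l}. \<not> continuous (at x within {0..l}) (sigma_coeff v pbar s)} \<subseteq> J" by blast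
  then show ?thesis using J finite_subset by blast
qed

end

theory Submission
  imports Defs
begin

text \<open>
  After the squared coefficient \<open>q = \<sigma>\<^sup>2\<close> has been extended to the line, evenly and
  \<open>2l\<close>-periodically, it is bounded, bounded away from \<open>0\<close> and continuous off finitely many points
  of each bounded interval. In polar coordinates \<open>\<phi> = r cos \<theta>\<close>, \<open>\<psi> = r sin \<theta>\<close>
  (Pruefer's substitution) the Sturm--Liouville system at frequency \<open>w\<close> decouples into
  \<open>\<theta>' = w (q cos\<^sup>2 \<theta> + sin\<^sup>2 \<theta>)\<close> and \<open>(ln r)' = w (q - 1) cos \<theta> sin \<theta>\<close>. The first equation
  is a scalar equation with a Lipschitz right-hand side and has a unique solution with
  \<open>\<theta> 0 = 0\<close> (\<open>angle_solution_exists\<close>, \<open>angle_solution_unique\<close>), after which \<open>r\<close> is found by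
  integration.

  The right-hand side of the angle equation is at least \<open>w\<close> times a positive constant. Hence
  \<open>\<theta> l\<close> is a continuous, strictly increasing and unbounded function of \<open>w \<ge> 0\<close> that vanishes at
  \<open>w = 0\<close> (\<open>angle_continuous_in_frequency\<close>, \<open>angle_strict_mono\<close>, \<open>angle_ge_linear\<close>). It therefore
  takes the value \<open>k \<pi> / 2\<close> at exactly one frequency \<open>\<omega>\<^sub>k\<close>. Since \<open>\<phi> l = 0\<close> says that \<open>\<theta> l\<close> is
  an odd multiple of \<open>\<pi> / 2\<close> and \<open>\<psi> l = 0\<close> that it is an even one, these are all the
  eigenfrequencies, in increasing order and with the required parity. A normalized solution on
  \<open>[0, l]\<close> is unique (\<open>linear_system_unique\<close>), so no eigenfrequency can come from another solution.

  At \<open>w = \<omega>\<^sub>k\<close> the reflections of the line in \<open>0\<close> and in \<open>l\<close> map solutions of the angle equation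
  to solutions, up to a sign and a multiple of \<open>\<pi>\<close>. Uniqueness turns this into
  \<open>\<theta> (- x) = - \<theta> x\<close> and \<open>\<theta> (2 l - x) = k \<pi> - \<theta> x\<close>, so that
  \<open>\<theta> (x + 4 l) = \<theta> x + 2 k \<pi>\<close>, and \<open>r\<close> is invariant under both reflections. This gives the
  period \<open>4 l\<close> in \<open>x\<close> (\<open>modes_periodic\<close>). The linearized equations, the period in time and the
  boundary conditions are then properties of the factors \<open>cos (\<omega>\<^sub>k t)\<close> and \<open>sin (\<omega>\<^sub>k t)\<close>; over a
  quarter period their argument grows by \<open>k \<pi> / 2\<close>, which makes the remaining trace at \<open>x = l\<close>
  even in the shifted time.
\<close>

section \<open>Differential inequalities with finitely many exceptional points\<close>

text \<open>
  Solutions are differentiable only off the jumps of the coefficient. All arguments with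
  differential inequalities rest on this form of the monotonicity criterion, which holds because the
  fundamental theorem of calculus tolerates finitely many exceptional points.
\<close>
lemma nondecreasing_except_finite:
  fixes f :: "real \<Rightarrow> real"
  assumes "finite S" "a \<le> b" "continuous_on {a..b} f"
    and deriv: "\<And>x. x \<in> {a<..<b} - S \<Longrightarrow> (f has_real_derivative f' x) (at x)"
    and nonneg: "\<And>x. x \<in> {a<..<b} - S \<Longrightarrow> 0 \<le> f' x"
  shows "f a \<le> f b"
proof -
  define g where "g x = (if x \<in> {a<..<b} - S then f' x else 0)" for x
  have "(g has_integral (f b - f a)) {a..b}"
  proof (rule fundamental_theorem_of_calculus_interior_strong[OF assms(1,2) _ assms(3)])
    fix x assume "x \<in> {a<..<b} - S"
    then show "(f has_vector_derivative g x) (at x)"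
      using deriv by (simp add: g_def has_real_derivative_iff_has_vector_derivative)
  qed
  then have "0 \<le> f b - f a"
    by (rule has_integral_nonneg) (auto simp: g_def nonneg)
  then show ?thesis by simp
qed

lemma gronwall_except_finite:
  fixes E :: "real \<Rightarrow> real"
  assumes "finite S" "a \<le> b" "continuous_on {a..b} E"
    and deriv: "\<And>x. x \<in> {a<..<b} - S \<Longrightarrow> (E has_real_derivative E' x) (at x)"
    and le: "\<And>x. x \<in> {a<..<b} - S \<Longrightarrow> E' x \<le> K * E x"
  shows "E b \<le> exp (K * (b - a)) * E a"
proof -
  have "- (E a * exp (- K * a)) \<le> - (E b * exp (- K * b))"
  proof (rule nondecreasing_except_finite[OF assms(1,2)])
    show "continuous_on {a..b} (\<lambda>x. - (E x * exp (- K * x)))"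
      by (intro continuous_intros assms)
    fix x assume x: "x \<in> {a<..<b} - S"
    show "((\<lambda>x. - (E x * exp (- K * x))) has_real_derivative
        (K * E x - E' x) * exp (- K * x)) (at x)"
      by (auto intro!: derivative_eq_intros deriv[OF x] simp: algebra_simps)
    show "0 \<le> (K * E x - E' x) * exp (- K * x)" using le[OF x] by simp
  qed
  then have "E b * exp (- K * b) * exp (K * b) \<le> E a * exp (- K * a) * exp (K * b)"
    by (intro mult_right_mono) auto
  then show ?thesis
    by (simp add: mult.assoc flip: exp_add) (simp add: algebra_simps)
qed

text \<open>
  The source of all uniqueness statements on the line: \<open>E\<close> will be the square of the difference of
  two solutions. \<open>E x exp (- K x)\<close> decreases and
  \<open>E x exp (K x)\<close> increases, so a zero spreads in both directions.
\<close>
lemma vanishes_if_vanishes_at_point: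
  fixes E :: "real \<Rightarrow> real"
  assumes finite: "\<And>a b. finite {x \<in> {a..b}. x \<in> S}"
    and cont: "continuous_on UNIV E"
    and deriv: "\<And>x. x \<notin> S \<Longrightarrow> (E has_real_derivative E' x) (at x)"
    and le: "\<And>x. x \<notin> S \<Longrightarrow> \<bar>E' x\<bar> \<le> K * E x"
    and "\<And>x. 0 \<le> E x" "E a = 0"
  shows "E x = 0"
proof (cases "a \<le> x")
  case True
  have "E x \<le> exp (K * (x - a)) * E a"
  proof (rule gronwall_except_finite[OF finite True])
    show "continuous_on {a..x} E" using cont continuous_on_subset by blast
    fix y assume "y \<in> {a<..<x} - {y \<in> {a..x}. y \<in> S}"
    then have "y \<notin> S" by auto
    then show "(E has_real_derivative E' y) (at y)" "E' y \<le> K * E y"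
      using deriv le by (auto simp: abs_le_iff)
  qed
  then show ?thesis using assms(5)[of x] assms(6) by simp
next
  case False
  have "E x * exp (K * x) \<le> E a * exp (K * a)"
  proof (rule nondecreasing_except_finite[where a = x and b = a, OF finite[of x a]])
    show "x \<le> a" using False by simp
    show "continuous_on {x..a} (\<lambda>x. E x * exp (K * x))"
      by (intro continuous_intros continuous_on_subset[OF cont]) auto
    fix y assume "y \<in> {x<..<a} - {y \<in> {x..a}. y \<in> S}"
    then have y: "y \<notin> S" by auto
    show "((\<lambda>x. E x * exp (K * x)) has_real_derivative (E' y + K * E y) * exp (K * y)) (at y)"
      by (auto intro!: derivative_eq_intros deriv[OF y] simp: algebra_simps)
    show "0 \<le> (E' y + K * E y) * exp (K * y)" using le[OF y] by simp
  qed
  then have "E x * exp (K * x) \<le> 0" using assms(6) by simp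
  then have "E x \<le> 0" by (simp add: mult_le_0_iff)
  then show ?thesis using assms(5)[of x] by simp
qed

text \<open>
  The estimate behind the contraction property of the Picard operator in the norm with weight
  \<open>exp (- K |x|)\<close>: integration gains the factor \<open>1 / K\<close>, however long the interval.
\<close>
lemma exponential_growth_bound:
  fixes B :: "real \<Rightarrow> real"
  assumes finite: "\<And>a b. finite {x \<in> {a..b}. x \<in> S}"
    and cont: "continuous_on UNIV B"
    and deriv: "\<And>x. x \<notin> S \<Longrightarrow> (B has_real_derivative B' x) (at x)"
    and le: "\<And>x. x \<notin> S \<Longrightarrow> \<bar>B' x\<bar> \<le> c * exp (K * \<bar>x\<bar>)"
    and "0 < K" "0 \<le> c" "B 0 = 0"
  shows "\<bar>B x\<bar> \<le> c / K * exp (K * \<bar>x\<bar>)"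
proof -
  have *: "e * B x \<le> c / K * exp (K * \<bar>x\<bar>)" if e: "\<bar>e\<bar> = 1" for e :: real
  proof (cases "0 \<le> x")
    case True
    have "c / K * exp (K * 0) - e * B 0 \<le> c / K * exp (K * x) - e * B x"
    proof (rule nondecreasing_except_finite[OF finite True])
      show "continuous_on {0..x} (\<lambda>x. c / K * exp (K * x) - e * B x)"
        by (intro continuous_intros continuous_on_subset[OF cont]) auto
      fix y assume y: "y \<in> {0<..<x} - {y \<in> {0..x}. y \<in> S}"
      then have yS: "y \<notin> S" by auto
      show "((\<lambda>x. c / K * exp (K * x) - e * B x) has_real_derivative
          c * exp (K * y) - e * B' y) (at y)"
        using \<open>0 < K\<close> by (auto intro!: derivative_eq_intros deriv[OF yS])
      have "e * B' y \<le> \<bar>e * B' y\<bar>" by simp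
      also have "\<dots> \<le> c * exp (K * y)" using e y le[OF yS] by (simp add: abs_mult)
      finally show "0 \<le> c * exp (K * y) - e * B' y" by simp
    qed
    then show ?thesis using True assms(5-7) by simp (smt (verit) divide_nonneg_pos)
  next
    case False
    have "e * B x - c / K * exp (- K * x) \<le> e * B 0 - c / K * exp (- K * 0)"
    proof (rule nondecreasing_except_finite[where a = x and b = 0, OF finite[of x 0]])
      show "x \<le> 0" using False by simp
      show "continuous_on {x..0} (\<lambda>x. e * B x - c / K * exp (- K * x))"
        by (intro continuous_intros continuous_on_subset[OF cont]) auto
      fix y assume y: "y \<in> {x<..<0} - {y \<in> {x..0}. y \<in> S}"
      then have yS: "y \<notin> S" by auto
      show "((\<lambda>x. e * B x - c / K * exp (- K * x)) has_real_derivative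
          e * B' y + c * exp (- K * y)) (at y)"
        using \<open>0 < K\<close> by (auto intro!: derivative_eq_intros deriv[OF yS])
      have "- (e * B' y) \<le> \<bar>e * B' y\<bar>" by simp
      also have "\<dots> \<le> c * exp (- K * y)" using e y le[OF yS] by (simp add: abs_mult)
      finally show "0 \<le> e * B' y + c * exp (- K * y)" by simp
    qed
    then show ?thesis using False assms(5-7) by simp (smt (verit) divide_nonneg_pos)
  qed
  from *[of 1] *[of "-1"] show ?thesis by simp
qed

text \<open>
  If \<open>D\<close> became negative, it would do so after a last zero \<open>z\<close>. To the right of \<open>z\<close> the function
  \<open>- D\<close> is positive and grows at most exponentially from the value \<open>0\<close>, which is absurd.
\<close>
lemma nonneg_if_deriv_ge:
  fixes D :: "real \<Rightarrow> real"
  assumes "finite S" "a \<le> b" "continuous_on {a..b} D" "0 \<le> D a"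
    and deriv: "\<And>x. x \<in> {a<..<b} - S \<Longrightarrow> (D has_real_derivative D' x) (at x)"
    and ge: "\<And>x. x \<in> {a<..<b} - S \<Longrightarrow> - (L * \<bar>D x\<bar>) \<le> D' x"
  shows "0 \<le> D b"
proof (rule ccontr)
  assume neg: "\<not> 0 \<le> D b"
  define Z where "Z = {a..b} \<inter> D -` {0..}"
  have "closed Z"
    unfolding Z_def by (intro continuous_closed_preimage assms) auto
  then have "compact Z"
    by (auto simp: compact_eq_bounded_closed Z_def intro: bounded_subset[OF bounded_closed_interval])
  moreover have "a \<in> Z" using assms by (auto simp: Z_def)
  ultimately obtain z where z: "z \<in> Z" "\<And>y. y \<in> Z \<Longrightarrow> y \<le> z"
    using compact_attains_sup[of Z] by blast
  have zab: "a \<le> z" "z \<le> b" "0 \<le> D z" using z by (auto simp: Z_def)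
  have "\<exists>y\<ge>z. y \<le> b \<and> D y = 0"
    using neg zab by (intro IVT2' continuous_on_subset[OF assms(3)]) auto
  then obtain y where "z \<le> y" "y \<le> b" "D y = 0" by auto
  then have "D z = 0" using z(2)[of y] zab by (auto simp: Z_def)
  have "- D b \<le> exp (L * (b - z)) * - D z"
  proof (rule gronwall_except_finite[OF assms(1) zab(2)])
    show "continuous_on {z..b} (\<lambda>x. - D x)"
      using zab by (intro continuous_intros continuous_on_subset[OF assms(3)]) auto
    fix x assume x: "x \<in> {z<..<b} - S"
    then have x': "x \<in> {a<..<b} - S" using zab by auto
    show "((\<lambda>x. - D x) has_real_derivative - D' x) (at x)"
      using deriv[OF x'] by (rule DERIV_minus)
    have "D x < 0" using x x' z(2)[of x] by (force simp: Z_def)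
    then show "- D' x \<le> L * - D x" using ge[OF x'] by simp
  qed
  then show False using neg \<open>D z = 0\<close> by simp
qed

section \<open>Antiderivatives of functions with isolated jumps\<close>

text \<open>
  The oriented integral from \<open>0\<close> to \<open>x\<close>; the sign for negative \<open>x\<close> makes it an antiderivative on
  the whole line.
\<close>
definition antideriv :: "(real \<Rightarrow> real) \<Rightarrow> real \<Rightarrow> real" where
  "antideriv f x = (if 0 \<le> x then integral {0..x} f else - integral {x..0} f)"

text \<open>
  Near any given point the two branches of the definition are one indefinite integral with a
  fixed lower limit, to which the theory of such integrals applies.
\<close>
lemma antideriv_eq:
  assumes "f integrable_on {- A..A}" "\<bar>x\<bar> \<le> A"
  shows "antideriv f x = integral {- A..x} f - integral {- A..0} f"
proof (cases "0 \<le> x")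
  case True
  have "f integrable_on {- A..x}"
    using assms by (intro integrable_subinterval_real[OF assms(1)]) auto
  then have "integral {- A..0} f + integral {0..x} f = integral {- A..x} f"
    using assms(2) True by (intro Henstock_Kurzweil_Integration.integral_combine) auto
  then show ?thesis using True by (simp add: antideriv_def)
next
  case False
  have "f integrable_on {- A..0}"
    using assms by (intro integrable_subinterval_real[OF assms(1)]) auto
  then have "integral {- A..x} f + integral {x..0} f = integral {- A..0} f"
    using assms(2) False by (intro Henstock_Kurzweil_Integration.integral_combine) auto
  then show ?thesis using False by (simp add: antideriv_def)
qed

lemma
  assumes "\<And>A. f integrable_on {- A..A}"
  shows antideriv_continuous: "continuous_on UNIV (antideriv f)"
    and antideriv_has_derivative:
      "isCont f x \<Longrightarrow> (antideriv f has_real_derivative f x) (at x)"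
proof -
  have near: "x \<in> {- (\<bar>x\<bar> + 1)<..<\<bar>x\<bar> + 1}" for x :: real by auto
  have "isCont (antideriv f) x" for x
  proof -
    define A where "A = \<bar>x\<bar> + 1"
    have "continuous_on {- A..A} (\<lambda>x. integral {- A..x} f - integral {- A..0} f)"
      by (intro continuous_intros indefinite_integral_continuous_1 assms)
    then have "continuous_on {- A..A} (antideriv f)"
      by (rule continuous_on_eq) (auto simp: antideriv_eq[OF assms, of _ A] abs_le_iff)
    then have "continuous_on {- A<..<A} (antideriv f)"
      by (rule continuous_on_subset) auto
    then show ?thesis
      using near[of x] by (simp add: A_def continuous_on_eq_continuous_at)
  qed
  then show "continuous_on UNIV (antideriv f)" by (simp add: continuous_at_imp_continuous_on)
  assume x: "isCont f x"
  define A where "A = \<bar>x\<bar> + 1"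
  have "((\<lambda>u. integral {- A..u} f) has_vector_derivative f x) (at x within {- A..A} - {})"
    using x near[of x]
    by (intro integral_has_vector_derivative_continuous_at assms)
       (auto simp: A_def intro: continuous_at_imp_continuous_at_within)
  then have "((\<lambda>u. integral {- A..u} f) has_real_derivative f x) (at x within {- A..A})"
    by (simp add: has_real_derivative_iff_has_vector_derivative)
  then have "((\<lambda>u. integral {- A..u} f) has_real_derivative f x) (at x)"
    using near[of x] by (subst (asm) at_within_interior) (auto simp: A_def)
  then have "((\<lambda>u. integral {- A..u} f - integral {- A..0} f) has_real_derivative f x) (at x)"
    by (auto intro!: derivative_eq_intros)
  then show "(antideriv f has_real_derivative f x) (at x)"
    by (rule has_field_derivative_transform_within_open[where S = "{- A<..<A}"])
       (use near[of x] in \<open>auto simp: antideriv_eq[OF assms, of _ A] A_def\<close>)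
qed

lemma integrable_if_bounded_finite_discontinuities:
  fixes f :: "real \<Rightarrow> real"
  assumes "\<And>x. \<bar>f x\<bar> \<le> C" and "finite {x \<in> {a..b}. \<not> isCont f x}"
  shows "f integrable_on {a..b}"
proof -
  define N where "N = {x \<in> {a..b}. \<not> isCont f x}"
  have N: "finite N" "negligible N" using assms(2) by (auto simp: N_def)
  have meas: "{a..b} - N \<in> sets lebesgue"
    using N by (simp add: negligible_imp_sets sets.Diff)
  have "f integrable_on ({a..b} - N)"
  proof (rule measurable_bounded_by_integrable_imp_integrable_real)
    have "continuous_on ({a..b} - N) f"
      by (rule continuous_at_imp_continuous_on) (auto simp: N_def)
    then show "f \<in> borel_measurable (lebesgue_on ({a..b} - N))"
      using meas by (rule continuous_imp_measurable_on_sets_lebesgue)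
    have "(\<lambda>x. C) integrable_on {a..b}" by auto
    then show "(\<lambda>x. C) integrable_on ({a..b} - N)"
      by (rule integrable_spike_set) (auto intro: negligible_subset[OF N(2)])
  qed (use assms meas in auto)
  then show ?thesis
    by (rule integrable_spike_set) (auto intro: negligible_subset[OF N(2)])
qed

section \<open>The angle equation\<close>

text \<open>
  The coefficient \<open>q\<close> plays the part of \<open>\<sigma>\<^sup>2\<close> on the line. The bounds are arranged around \<open>1\<close>, the
  coefficient of \<open>sin\<^sup>2\<close> in the angle equation, so that they are bounds for the whole rate.
\<close>
locale bounded_coefficient =
  fixes q :: "real \<Rightarrow> real" and c M :: real
  assumes c_pos: "0 < c" and M_ge_1: "1 \<le> M" and c_le_1: "c \<le> 1"
    and q_ge: "c \<le> q x" and q_le: "q x \<le> M"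
    and finite_jumps: "finite {x \<in> {a..b}. \<not> isCont q x}"
begin

text \<open>
  The shape in which the lemmas on differential inequalities expect the exceptional set.
\<close>
lemma finite_jumps': "finite {x \<in> {a..b}. x \<in> {x. \<not> isCont q x}}"
  using finite_jumps by simp

definition rate :: "real \<Rightarrow> real \<Rightarrow> real" where
  "rate x t = q x * (cos t)\<^sup>2 + (sin t)\<^sup>2"

lemma rate_alt: "rate x t = 1 + (q x - 1) * (cos t)\<^sup>2"
  unfolding rate_def sin_squared_eq by (simp add: algebra_simps)

lemma rate_ge: "c \<le> rate x t"
proof -
  have "c * ((cos t)\<^sup>2 + (sin t)\<^sup>2) \<le> rate x t"
    unfolding rate_def distrib_left
    using q_ge[of x] c_le_1 c_pos by (intro add_mono mult_right_mono mult_left_le_one_le) auto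
  then show ?thesis by simp
qed

lemma rate_le: "rate x t \<le> M"
proof -
  have "rate x t \<le> M * ((cos t)\<^sup>2 + (sin t)\<^sup>2)"
    unfolding rate_def distrib_left
    using q_le[of x] M_ge_1 by (intro add_mono mult_right_mono) (auto simp: mult_le_cancel_right1)
  then show ?thesis by simp
qed

lemma rate_pos: "0 < rate x t"
  using rate_ge[of x t] c_pos by linarith

lemma abs_q_minus_1_le: "\<bar>q x - 1\<bar> \<le> M"
  using q_ge[of x] q_le[of x] c_pos M_ge_1 by linarith

text \<open>
  The identity \<open>cos\<^sup>2 s - cos\<^sup>2 t = - sin (s + t) sin (s - t)\<close> gives the Lipschitz constant.
\<close>
lemma rate_lipschitz: "\<bar>rate x s - rate x t\<bar> \<le> M * \<bar>s - t\<bar>"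
proof -
  have "sin (s + t) * sin (s - t) = (sin s)\<^sup>2 * (cos t)\<^sup>2 - (cos s)\<^sup>2 * (sin t)\<^sup>2"
    by (simp add: sin_add sin_diff power2_eq_square algebra_simps)
  then have "(cos s)\<^sup>2 - (cos t)\<^sup>2 = - (sin (s + t) * sin (s - t))"
    by (simp add: sin_squared_eq algebra_simps)
  then have "\<bar>(cos s)\<^sup>2 - (cos t)\<^sup>2\<bar> = \<bar>sin (s + t)\<bar> * \<bar>sin (s - t)\<bar>"
    by (simp add: abs_mult)
  also have "\<dots> \<le> 1 * \<bar>s - t\<bar>"
    by (intro mult_mono abs_sin_x_le_abs_x) auto
  finally have "\<bar>q x - 1\<bar> * \<bar>(cos s)\<^sup>2 - (cos t)\<^sup>2\<bar> \<le> M * \<bar>s - t\<bar>"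
    using abs_q_minus_1_le[of x] M_ge_1 by (intro mult_mono) auto
  then show ?thesis
    unfolding abs_mult[symmetric] by (simp add: rate_alt right_diff_distrib)
qed

definition angle_solution :: "real \<Rightarrow> (real \<Rightarrow> real) \<Rightarrow> bool" where
  "angle_solution w \<theta> \<longleftrightarrow> continuous_on UNIV \<theta> \<and>
     (\<forall>x. isCont q x \<longrightarrow> (\<theta> has_real_derivative w * rate x (\<theta> x)) (at x))"

text \<open>
  The initial point is arbitrary: the symmetries are obtained by comparison at \<open>0\<close> and at \<open>l\<close>.
\<close>
lemma angle_solution_unique:
  assumes "angle_solution w \<theta>" "angle_solution w \<eta>" "0 \<le> w" "\<theta> a = \<eta> a"
  shows "\<theta> x = \<eta> x"
proof -
  have "(\<theta> x - \<eta> x)\<^sup>2 = 0"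
  proof (rule vanishes_if_vanishes_at_point[where E = "\<lambda>x. (\<theta> x - \<eta> x)\<^sup>2" and a = a, OF finite_jumps'])
    show "continuous_on UNIV (\<lambda>x. (\<theta> x - \<eta> x)\<^sup>2)"
      using assms by (auto simp: angle_solution_def intro!: continuous_intros)
    show "(\<theta> a - \<eta> a)\<^sup>2 = 0" using assms by simp
    fix y assume "y \<notin> {x. \<not> isCont q x}"
    then have y: "isCont q y" by simp
    show "((\<lambda>x. (\<theta> x - \<eta> x)\<^sup>2) has_real_derivative
        2 * (\<theta> y - \<eta> y) * (w * rate y (\<theta> y) - w * rate y (\<eta> y))) (at y)"
      using assms y by (auto simp: angle_solution_def intro!: derivative_eq_intros)
    have "\<bar>2 * (\<theta> y - \<eta> y) * (w * rate y (\<theta> y) - w * rate y (\<eta> y))\<bar>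
        = 2 * w * \<bar>\<theta> y - \<eta> y\<bar> * \<bar>rate y (\<theta> y) - rate y (\<eta> y)\<bar>"
      unfolding right_diff_distrib[of w, symmetric] abs_mult using assms(3) by simp
    also have "\<dots> \<le> 2 * w * \<bar>\<theta> y - \<eta> y\<bar> * (M * \<bar>\<theta> y - \<eta> y\<bar>)"
      using assms(3) by (intro mult_left_mono rate_lipschitz) auto
    also have "\<dots> = 2 * w * M * (\<theta> y - \<eta> y)\<^sup>2"
      by (simp add: power2_eq_square)
    finally show "\<bar>2 * (\<theta> y - \<eta> y) * (w * rate y (\<theta> y) - w * rate y (\<eta> y))\<bar>
        \<le> 2 * w * M * (\<theta> y - \<eta> y)\<^sup>2" .
  qed simp
  then show ?thesis by simp
qed

lemma
  assumes "\<And>x. \<bar>f x\<bar> \<le> C" and f: "\<And>x. isCont q x \<Longrightarrow> isCont f x"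
  shows antideriv_coefficient_continuous: "continuous_on UNIV (antideriv f)"
    and antideriv_coefficient_deriv:
      "isCont q x \<Longrightarrow> (antideriv f has_real_derivative f x) (at x)"
proof -
  have "f integrable_on {- A..A}" for A
  proof (rule integrable_if_bounded_finite_discontinuities[OF assms(1)])
    show "finite {x \<in> {- A..A}. \<not> isCont f x}"
      by (rule finite_subset[OF _ finite_jumps[of "- A" A]]) (auto dest: f)
  qed
  then show "continuous_on UNIV (antideriv f)"
    and "isCont q x \<Longrightarrow> (antideriv f has_real_derivative f x) (at x)"
    by (auto intro: antideriv_continuous antideriv_has_derivative f)
qed

text \<open>
  Picard iteration on the whole line at once. The unknown is \<open>u x = exp (- K |x|) \<theta> x\<close>, which is
  bounded because \<open>\<theta>\<close> grows at most linearly; on bounded continuous functions \<open>u\<close> the integral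
  operator has Lipschitz constant \<open>w M / K \<le> 1/2\<close> for the choice of \<open>K\<close> below.
\<close>
lemma angle_solution_exists:
  assumes "0 \<le> w"
  shows "\<exists>\<theta>. angle_solution w \<theta> \<and> \<theta> 0 = 0"
proof -
  define K where "K = 2 * w * M + 1"
  have K: "0 < K" using assms M_ge_1 by (simp add: K_def add_nonneg_pos)
  define f where "f u y = w * rate y (exp (K * \<bar>y\<bar>) * apply_bcontfun u y)" for u y
  define F where "F u = antideriv (f u)" for u
  have f_le: "\<bar>f u y\<bar> \<le> w * M" for u y
    unfolding f_def using assms rate_pos[of y] rate_le[of y]
    by (simp add: abs_mult mult_left_mono less_imp_le)
  have f_cont: "isCont (f u) x" if "isCont q x" for u x
  proof -
    have "isCont (apply_bcontfun u) x"
      by (metis UNIV_I continuous_on_apply_bcontfun continuous_on_eq_continuous_at open_UNIV)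
    then show ?thesis unfolding f_def rate_def using that by (intro continuous_intros) auto
  qed
  have F_cont: "continuous_on UNIV (F u)" for u
    unfolding F_def by (rule antideriv_coefficient_continuous[OF f_le f_cont])
  have F_deriv: "(F u has_real_derivative f u x) (at x)" if "isCont q x" for u x
    unfolding F_def by (rule antideriv_coefficient_deriv[OF f_le f_cont that])
  have F_0: "F u 0 = 0" for u by (simp add: F_def antideriv_def)
  have F_le: "\<bar>F u x\<bar> \<le> w * M / K * exp (K * \<bar>x\<bar>)" for u x
  proof (rule exponential_growth_bound[OF finite_jumps' F_cont _ _ K _ F_0])
    fix y assume "y \<notin> {x. \<not> isCont q x}"
    then show "(F u has_real_derivative f u y) (at y)" by (simp add: F_deriv)
    \<comment> \<open>The bound on \<open>f\<close> is constant; it is relaxed to fit the exponential weight.\<close>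
    have "w * M * 1 \<le> w * M * exp (K * \<bar>y\<bar>)"
      using assms M_ge_1 K by (intro mult_left_mono) auto
    then show "\<bar>f u y\<bar> \<le> w * M * exp (K * \<bar>y\<bar>)" using f_le[of u y] by linarith
  qed (use assms M_ge_1 in auto)
  define T where "T u = Bcontfun (\<lambda>x. exp (- K * \<bar>x\<bar>) * F u x)" for u
  have T: "apply_bcontfun (T u) x = exp (- K * \<bar>x\<bar>) * F u x" for u x
  proof -
    have "(\<lambda>x. exp (- K * \<bar>x\<bar>) * F u x) \<in> bcontfun"
    proof (rule bcontfun_normI)
      show "continuous_on UNIV (\<lambda>x. exp (- K * \<bar>x\<bar>) * F u x)"
        by (intro continuous_intros F_cont)
      fix y
      have "exp (- K * \<bar>y\<bar>) * \<bar>F u y\<bar> \<le> exp (- K * \<bar>y\<bar>) * (w * M / K * exp (K * \<bar>y\<bar>))"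
        by (intro mult_left_mono F_le) auto
      then show "norm (exp (- K * \<bar>y\<bar>) * F u y) \<le> w * M / K"
        by (simp add: abs_mult exp_minus field_simps)
    qed
    then show ?thesis by (simp add: T_def Bcontfun_inverse)
  qed
  have "\<exists>!u. T u = u"
  proof (rule banach_fix_type[where c = "1/2"])
    show "\<forall>u v. dist (T u) (T v) \<le> 1/2 * dist u v"
    proof (intro allI dist_bound)
      fix u v x
      have F_diff: "\<bar>F u x - F v x\<bar> \<le> w * M * dist u v / K * exp (K * \<bar>x\<bar>)"
      proof (rule exponential_growth_bound[OF finite_jumps' _ _ _ K])
        show "continuous_on UNIV (\<lambda>x. F u x - F v x)" by (intro continuous_intros F_cont)
        show "0 \<le> w * M * dist u v" using assms M_ge_1 by simp
        show "F u 0 - F v 0 = 0" by (simp add: F_0)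
        fix y assume "y \<notin> {x. \<not> isCont q x}"
        then show "((\<lambda>x. F u x - F v x) has_real_derivative (f u y - f v y)) (at y)"
          by (auto intro!: DERIV_diff F_deriv)
        have "\<bar>f u y - f v y\<bar> \<le> w * (M * \<bar>exp (K * \<bar>y\<bar>) * u y - exp (K * \<bar>y\<bar>) * v y\<bar>)"
          unfolding f_def right_diff_distrib[of w, symmetric] abs_mult[of w] abs_of_nonneg[OF assms]
          by (intro mult_left_mono rate_lipschitz assms)
        also have "\<dots> = w * M * dist (u y) (v y) * exp (K * \<bar>y\<bar>)"
          unfolding right_diff_distrib[symmetric] abs_mult dist_real_def by simp
        also have "\<dots> \<le> w * M * dist u v * exp (K * \<bar>y\<bar>)"
          using assms M_ge_1 by (intro mult_right_mono mult_left_mono dist_bounded) auto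
        finally show "\<bar>f u y - f v y\<bar> \<le> w * M * dist u v * exp (K * \<bar>y\<bar>)" .
      qed
      have "dist (T u x) (T v x) = exp (- K * \<bar>x\<bar>) * \<bar>F u x - F v x\<bar>"
        unfolding T dist_real_def right_diff_distrib[symmetric] abs_mult by simp
      also have "\<dots> \<le> exp (- K * \<bar>x\<bar>) * (w * M * dist u v / K * exp (K * \<bar>x\<bar>))"
        by (intro mult_left_mono F_diff) auto
      also have "\<dots> = w * M / K * dist u v" by (simp add: exp_minus field_simps)
      also have "\<dots> \<le> 1/2 * dist u v"
        using K assms M_ge_1 by (intro mult_right_mono) (auto simp: K_def field_simps)
      finally show "dist (T u x) (T v x) \<le> 1/2 * dist u v" .
    qed
  qed auto
  then obtain u where u: "T u = u" by auto
  have "exp (K * \<bar>x\<bar>) * u x = F u x" for x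
    using T[of u x] u by (simp add: exp_minus field_simps)
  then have "f u x = w * rate x (F u x)" for x by (simp add: f_def)
  then have "angle_solution w (F u)"
    unfolding angle_solution_def using F_cont F_deriv[of _ u] by metis
  then show ?thesis using F_0 by blast
qed

definition angle :: "real \<Rightarrow> real \<Rightarrow> real" where
  "angle w = (SOME \<theta>. angle_solution w \<theta> \<and> \<theta> 0 = 0)"

context
  fixes w :: real
  assumes w: "0 \<le> w"
begin

lemma angle_solution_angle: "angle_solution w (angle w)"
  and angle_0 [simp]: "angle w 0 = 0"
  using someI_ex[OF angle_solution_exists[OF w]] by (simp_all add: angle_def)

lemma angle_continuous: "continuous_on A (angle w)"
  using angle_solution_angle by (auto simp: angle_solution_def intro: continuous_on_subset)

lemma angle_deriv: "isCont q x \<Longrightarrow> (angle w has_real_derivative w * rate x (angle w x)) (at x)"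
  using angle_solution_angle by (simp add: angle_solution_def)

end

lemma angle_ge_linear:
  assumes "0 \<le> w" "0 \<le> x"
  shows "w * c * x \<le> angle w x"
proof -
  have "angle w 0 - w * c * 0 \<le> angle w x - w * c * x"
  proof (rule nondecreasing_except_finite[OF finite_jumps' assms(2)])
    show "continuous_on {0..x} (\<lambda>x. angle w x - w * c * x)"
      by (intro continuous_intros angle_continuous assms)
    fix y assume "y \<in> {0<..<x} - {y \<in> {0..x}. y \<in> {x. \<not> isCont q x}}"
    then show "((\<lambda>x. angle w x - w * c * x) has_real_derivative
        w * (rate y (angle w y) - c)) (at y)"
      using assms by (auto intro!: derivative_eq_intros angle_deriv simp: algebra_simps)
    show "0 \<le> w * (rate y (angle w y) - c)" using assms rate_ge by simp
  qed
  then show ?thesis using assms by simp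
qed

lemma angle_rate_diff:
  "w2 * rate x s - w1 * rate x t = (w2 - w1) * rate x s + w1 * (rate x s - rate x t)"
  by (simp add: algebra_simps)

text \<open>
  The difference \<open>D\<close> of the two angles satisfies \<open>D' \<ge> (w2 - w1) c - w1 M |D|\<close>: the faster
  frequency contributes the positive constant, and the Lipschitz bound controls the rest. Hence
  \<open>D\<close> stays nonnegative, and then \<open>D x exp (L x)\<close> with \<open>L = w1 M\<close> grows at least linearly.
\<close>
lemma angle_strict_mono:
  assumes w: "0 \<le> w1" "w1 < w2" and "0 < x"
  shows "angle w1 x < angle w2 x"
proof -
  define D where "D x = angle w2 x - angle w1 x" for x
  define D' where "D' x = w2 * rate x (angle w2 x) - w1 * rate x (angle w1 x)" for x
  have D_cont: "continuous_on A D" for A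
    unfolding D_def using w by (intro continuous_intros angle_continuous) auto
  have D_deriv: "(D has_real_derivative D' y) (at y)" if "isCont q y" for y
    unfolding D_def D'_def using w that by (intro DERIV_diff angle_deriv) auto
  have D'_ge: "(w2 - w1) * c - w1 * M * \<bar>D y\<bar> \<le> D' y" for y
  proof -
    have "(w2 - w1) * c \<le> (w2 - w1) * rate y (angle w2 y)"
      using w by (intro mult_left_mono rate_ge) auto
    moreover have "w1 * - (M * \<bar>D y\<bar>) \<le> w1 * (rate y (angle w2 y) - rate y (angle w1 y))"
      using rate_lipschitz[of y "angle w2 y" "angle w1 y"] w
      by (intro mult_left_mono) (auto simp: D_def abs_le_iff)
    ultimately show ?thesis unfolding D'_def angle_rate_diff by simp
  qed
  have D_nonneg: "0 \<le> D y" if "0 \<le> y" for y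
  proof (rule nonneg_if_deriv_ge[OF finite_jumps' that D_cont])
    show "0 \<le> D 0" using w by (simp add: D_def)
    fix z assume "z \<in> {0<..<y} - {z \<in> {0..y}. z \<in> {x. \<not> isCont q x}}"
    then show "(D has_real_derivative D' z) (at z)" by (auto intro: D_deriv)
    have "0 \<le> (w2 - w1) * c" using w c_pos by simp
    then show "- (w1 * M * \<bar>D z\<bar>) \<le> D' z" using D'_ge[of z] by linarith
  qed
  define L where "L = w1 * M"
  have L: "0 \<le> L" using w M_ge_1 by (simp add: L_def)
  have "D 0 * exp (L * 0) - (w2 - w1) * c * 0 \<le> D x * exp (L * x) - (w2 - w1) * c * x"
  proof (rule nondecreasing_except_finite[where a = 0 and b = x, OF finite_jumps'])
    show "0 \<le> x" using assms by simp
    show "continuous_on {0..x} (\<lambda>x. D x * exp (L * x) - (w2 - w1) * c * x)"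
      by (intro continuous_intros D_cont)
    fix y assume y: "y \<in> {0<..<x} - {y \<in> {0..x}. y \<in> {x. \<not> isCont q x}}"
    then show "((\<lambda>x. D x * exp (L * x) - (w2 - w1) * c * x) has_real_derivative
        (D' y + L * D y) * exp (L * y) - (w2 - w1) * c) (at y)"
      by (auto intro!: derivative_eq_intros D_deriv simp: algebra_simps)
    have "0 < (w2 - w1) * c" and "(w2 - w1) * c \<le> D' y + L * D y"
      using y w c_pos D'_ge[of y] D_nonneg[of y] by (auto simp: L_def)
    then have "(w2 - w1) * c * 1 \<le> (D' y + L * D y) * exp (L * y)"
      using y L by (intro mult_mono) auto
    then show "0 \<le> (D' y + L * D y) * exp (L * y) - (w2 - w1) * c" by simp
  qed
  moreover have "0 < (w2 - w1) * c * x" using assms c_pos by simp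
  ultimately have "0 < D x * exp (L * x)" using w by (simp add: D_def)
  then show ?thesis by (simp add: D_def zero_less_mult_iff)
qed

text \<open>
  A Gronwall estimate for \<open>D\<^sup>2 + \<delta>\<^sup>2\<close>, where \<open>D\<close> is the difference of the angles and
  \<open>\<delta> = |w2 - w1| M\<close> bounds the inhomogeneity in its equation; adding \<open>\<delta>\<^sup>2\<close> makes the inequality
  homogeneous.
\<close>
lemma angle_dependence:
  assumes w: "0 \<le> w1" "0 \<le> w2" and "0 \<le> x"
  shows "(angle w2 x - angle w1 x)\<^sup>2 \<le> exp ((1 + 2 * w1 * M) * x) * ((w2 - w1) * M)\<^sup>2"
proof -
  define D where "D x = angle w2 x - angle w1 x" for x
  define D' where "D' x = w2 * rate x (angle w2 x) - w1 * rate x (angle w1 x)" for x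
  define \<delta> where "\<delta> = \<bar>w2 - w1\<bar> * M"
  have \<delta>: "\<delta>\<^sup>2 = ((w2 - w1) * M)\<^sup>2" by (simp add: \<delta>_def power_mult_distrib)
  have "(D x)\<^sup>2 + \<delta>\<^sup>2 \<le> exp ((1 + 2 * w1 * M) * (x - 0)) * ((D 0)\<^sup>2 + \<delta>\<^sup>2)"
  proof (rule gronwall_except_finite[OF finite_jumps' assms(3)])
    show "continuous_on {0..x} (\<lambda>x. (D x)\<^sup>2 + \<delta>\<^sup>2)"
      unfolding D_def using w by (intro continuous_intros angle_continuous) auto
    fix y assume "y \<in> {0<..<x} - {y \<in> {0..x}. y \<in> {x. \<not> isCont q x}}"
    then have y: "isCont q y" by auto
    have "(D has_real_derivative D' y) (at y)"
      unfolding D_def D'_def using w y by (intro DERIV_diff angle_deriv) auto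
    then show "((\<lambda>x. (D x)\<^sup>2 + \<delta>\<^sup>2) has_real_derivative 2 * D y * D' y) (at y)"
      by (auto intro!: derivative_eq_intros)
    have "\<bar>D' y\<bar> \<le> \<bar>(w2 - w1) * rate y (angle w2 y)\<bar> +
        \<bar>w1 * (rate y (angle w2 y) - rate y (angle w1 y))\<bar>"
      unfolding D'_def angle_rate_diff by (rule abs_triangle_ineq)
    also have "\<dots> \<le> \<delta> + w1 * (M * \<bar>D y\<bar>)"
      unfolding abs_mult \<delta>_def D_def using w rate_pos[of y "angle w2 y"]
      by (intro add_mono mult_mono rate_lipschitz) (auto simp: rate_le)
    finally have D'_le: "\<bar>D' y\<bar> \<le> \<delta> + w1 * (M * \<bar>D y\<bar>)" .
    have "2 * D y * D' y \<le> 2 * \<bar>D y\<bar> * \<bar>D' y\<bar>"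
      by (metis abs_ge_self abs_mult abs_numeral mult.assoc)
    also have "\<dots> \<le> 2 * \<bar>D y\<bar> * (\<delta> + w1 * (M * \<bar>D y\<bar>))"
      using D'_le by (intro mult_left_mono) auto
    also have "\<dots> = 2 * \<bar>D y\<bar> * \<delta> + 2 * w1 * M * (D y)\<^sup>2"
      by (simp add: distrib_left power2_eq_square)
    also have "\<dots> \<le> ((D y)\<^sup>2 + \<delta>\<^sup>2) + 2 * w1 * M * ((D y)\<^sup>2 + \<delta>\<^sup>2)"
      using sum_squares_bound[of "\<bar>D y\<bar>" \<delta>] w M_ge_1 by (intro add_mono mult_left_mono) auto
    finally show "2 * D y * D' y \<le> (1 + 2 * w1 * M) * ((D y)\<^sup>2 + \<delta>\<^sup>2)"
      by (simp add: algebra_simps)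
  qed
  then show ?thesis using w by (simp add: D_def \<delta>) (smt (verit) zero_le_power2)
qed

lemma angle_continuous_in_frequency:
  assumes "0 \<le> x"
  shows "continuous_on {0..} (\<lambda>w. angle w x)"
  unfolding continuous_on_def
proof
  fix w1 :: real assume w1: "w1 \<in> {0..}"
  define C where "C = exp ((1 + 2 * w1 * M) * x / 2) * M"
  have C: "0 \<le> C" using M_ge_1 by (simp add: C_def)
  have bound: "\<bar>angle w2 x - angle w1 x\<bar> \<le> C * \<bar>w2 - w1\<bar>" if "0 \<le> w2" for w2
  proof -
    have "(exp ((1 + 2 * w1 * M) * x / 2))\<^sup>2 = exp ((1 + 2 * w1 * M) * x)"
      by (simp flip: exp_double)
    then have "(C * \<bar>w2 - w1\<bar>)\<^sup>2 = exp ((1 + 2 * w1 * M) * x) * ((w2 - w1) * M)\<^sup>2"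
      by (simp add: C_def power_mult_distrib)
    then have "\<bar>angle w2 x - angle w1 x\<bar>\<^sup>2 \<le> (C * \<bar>w2 - w1\<bar>)\<^sup>2"
      using angle_dependence[of w1 w2 x] w1 that assms by simp
    then show ?thesis by (rule power2_le_imp_le) (simp add: C)
  qed
  have "((\<lambda>w2. angle w2 x - angle w1 x) \<longlongrightarrow> 0) (at w1 within {0..})"
  proof (rule Lim_null_comparison)
    show "\<forall>\<^sub>F w2 in at w1 within {0..}. norm (angle w2 x - angle w1 x) \<le> C * \<bar>w2 - w1\<bar>"
      using bound by (auto simp: eventually_at_filter)
    show "((\<lambda>w2. C * \<bar>w2 - w1\<bar>) \<longlongrightarrow> 0) (at w1 within {0..})"
      by (auto intro!: tendsto_eq_intros)
  qed
  then show "((\<lambda>w. angle w x) \<longlongrightarrow> angle w1 x) (at w1 within {0..})"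
    by (rule LIM_zero_cancel)
qed

section \<open>The normalized solution of the Sturm--Liouville system\<close>

definition log_amplitude :: "real \<Rightarrow> real \<Rightarrow> real" where
  "log_amplitude w = antideriv (\<lambda>x. w * (q x - 1) * cos (angle w x) * sin (angle w x))"

definition pressure_mode :: "real \<Rightarrow> real \<Rightarrow> real" where
  "pressure_mode w x = exp (log_amplitude w x) * cos (angle w x)"

definition velocity_mode :: "real \<Rightarrow> real \<Rightarrow> real" where
  "velocity_mode w x = exp (log_amplitude w x) * sin (angle w x)"

lemma log_amplitude_0 [simp]: "log_amplitude w 0 = 0"
  by (simp add: log_amplitude_def antideriv_def)

context
  fixes w :: real
  assumes w: "0 \<le> w"
begin

lemma log_amplitude_continuous: "continuous_on UNIV (log_amplitude w)"
  and log_amplitude_deriv: "isCont q x \<Longrightarrow>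
    (log_amplitude w has_real_derivative w * (q x - 1) * cos (angle w x) * sin (angle w x)) (at x)"
proof -
  define f where "f x = w * (q x - 1) * cos (angle w x) * sin (angle w x)" for x
  have f_le: "\<bar>f x\<bar> \<le> w * M * 1 * 1" for x
    unfolding f_def abs_mult using w abs_q_minus_1_le[of x] M_ge_1
    by (intro mult_mono) (auto simp: w)
  have f_cont: "isCont f x" if "isCont q x" for x
  proof -
    have "isCont (angle w) x"
      using angle_continuous[OF w, of UNIV] by (simp add: continuous_on_eq_continuous_at)
    then show ?thesis unfolding f_def using that by (intro continuous_intros) auto
  qed
  have eq: "log_amplitude w = antideriv f"
    unfolding log_amplitude_def f_def[abs_def] ..
  show "continuous_on UNIV (log_amplitude w)"
    using antideriv_coefficient_continuous[OF f_le f_cont] by (simp add: eq)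
  show "isCont q x \<Longrightarrow> (log_amplitude w has_real_derivative
      w * (q x - 1) * cos (angle w x) * sin (angle w x)) (at x)"
    using antideriv_coefficient_deriv[OF f_le f_cont] by (simp add: eq f_def)
qed

lemma pressure_mode_0 [simp]: "pressure_mode w 0 = 1"
  and velocity_mode_0 [simp]: "velocity_mode w 0 = 0"
  using w by (simp_all add: pressure_mode_def velocity_mode_def)

lemma pressure_mode_continuous: "continuous_on A (pressure_mode w)"
  and velocity_mode_continuous: "continuous_on A (velocity_mode w)"
  unfolding pressure_mode_def velocity_mode_def
  by (intro continuous_intros angle_continuous[OF w]
        continuous_on_subset[OF log_amplitude_continuous] subset_UNIV)+

lemma pressure_mode_deriv:
  assumes "isCont q x"
  shows "(pressure_mode w has_real_derivative - (w * velocity_mode w x)) (at x)"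
proof -
  let ?c = "cos (angle w x)" and ?s = "sin (angle w x)" and ?r = "exp (log_amplitude w x)"
  have "(pressure_mode w has_real_derivative
      ?r * (w * (q x - 1) * ?c * ?s) * ?c + ?r * (- ?s * (w * rate x (angle w x)))) (at x)"
    unfolding pressure_mode_def
    by (auto intro!: derivative_eq_intros log_amplitude_deriv angle_deriv assms w)
  moreover have "?r * (w * (q x - 1) * ?c * ?s) * ?c + ?r * (- ?s * (w * rate x (angle w x)))
      = - (w * velocity_mode w x)"
    by (simp add: rate_alt velocity_mode_def power2_eq_square algebra_simps)
  ultimately show ?thesis by simp
qed

lemma velocity_mode_deriv:
  assumes "isCont q x"
  shows "(velocity_mode w has_real_derivative q x * w * pressure_mode w x) (at x)"
proof -
  let ?c = "cos (angle w x)" and ?s = "sin (angle w x)" and ?r = "exp (log_amplitude w x)"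
  have "(velocity_mode w has_real_derivative
      ?r * (w * (q x - 1) * ?c * ?s) * ?s + ?r * (?c * (w * rate x (angle w x)))) (at x)"
    unfolding velocity_mode_def
    by (auto intro!: derivative_eq_intros log_amplitude_deriv angle_deriv assms w)
  moreover have "?r * (w * (q x - 1) * ?c * ?s) * ?s + ?r * (?c * (w * rate x (angle w x)))
      = ?r * w * ?c * ((q x - 1) * (?s)\<^sup>2 + rate x (angle w x))"
    by (simp add: power2_eq_square algebra_simps)
  moreover have "(q x - 1) * (?s)\<^sup>2 + rate x (angle w x) = q x"
    by (simp add: rate_alt sin_squared_eq algebra_simps)
  ultimately show ?thesis by (simp add: pressure_mode_def mult_ac)
qed

text \<open>
  For the differences \<open>\<alpha>\<close> and \<open>\<beta>\<close> of the two components,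
  \<open>(\<alpha>\<^sup>2 + \<beta>\<^sup>2)' = 2 w (q - 1) \<alpha> \<beta> \<le> w M (\<alpha>\<^sup>2 + \<beta>\<^sup>2)\<close>.
\<close>
lemma linear_system_unique:
  assumes cont: "continuous_on {0..l} \<phi>" "continuous_on {0..l} \<psi>"
    and init: "\<phi> 0 = 1" "\<psi> 0 = 0"
    and \<phi>: "\<And>x. x \<in> {0<..<l} \<Longrightarrow> isCont q x \<Longrightarrow> (\<phi> has_real_derivative - (w * \<psi> x)) (at x)"
    and \<psi>: "\<And>x. x \<in> {0<..<l} \<Longrightarrow> isCont q x \<Longrightarrow> (\<psi> has_real_derivative q x * w * \<phi> x) (at x)"
    and "x \<in> {0..l}"
  shows "\<phi> x = pressure_mode w x" and "\<psi> x = velocity_mode w x"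
proof -
  define \<alpha> where "\<alpha> x = \<phi> x - pressure_mode w x" for x
  define \<beta> where "\<beta> x = \<psi> x - velocity_mode w x" for x
  have x: "0 \<le> x" "x \<le> l" using assms by auto
  have "(\<alpha> x)\<^sup>2 + (\<beta> x)\<^sup>2 \<le> exp (w * M * (x - 0)) * ((\<alpha> 0)\<^sup>2 + (\<beta> 0)\<^sup>2)"
  proof (rule gronwall_except_finite[OF finite_jumps' x(1)])
    show "continuous_on {0..x} (\<lambda>x. (\<alpha> x)\<^sup>2 + (\<beta> x)\<^sup>2)"
      unfolding \<alpha>_def \<beta>_def using x
      by (intro continuous_intros pressure_mode_continuous velocity_mode_continuous
            continuous_on_subset[OF cont(1)] continuous_on_subset[OF cont(2)]) auto
    fix y assume "y \<in> {0<..<x} - {y \<in> {0..x}. y \<in> {x. \<not> isCont q x}}"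
    then have y: "y \<in> {0<..<l}" "isCont q y" using x by auto
    have "(\<alpha> has_real_derivative - (w * \<beta> y)) (at y)"
      unfolding \<alpha>_def \<beta>_def using DERIV_diff[OF \<phi>[OF y] pressure_mode_deriv[OF y(2)]]
      by (simp add: algebra_simps)
    moreover have "(\<beta> has_real_derivative q y * w * \<alpha> y) (at y)"
      unfolding \<alpha>_def \<beta>_def using DERIV_diff[OF \<psi>[OF y] velocity_mode_deriv[OF y(2)]]
      by (simp add: algebra_simps)
    ultimately show "((\<lambda>x. (\<alpha> x)\<^sup>2 + (\<beta> x)\<^sup>2) has_real_derivative
        w * (q y - 1) * (2 * \<alpha> y * \<beta> y)) (at y)"
      by (auto intro!: derivative_eq_intros simp: algebra_simps)
    have "w * (q y - 1) * (2 * \<alpha> y * \<beta> y) \<le> \<bar>w * (q y - 1)\<bar> * \<bar>2 * \<alpha> y * \<beta> y\<bar>"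
      unfolding abs_mult[symmetric] by simp
    also have "\<dots> \<le> w * M * ((\<alpha> y)\<^sup>2 + (\<beta> y)\<^sup>2)"
    proof (rule mult_mono)
      show "\<bar>w * (q y - 1)\<bar> \<le> w * M"
        unfolding abs_mult using w abs_q_minus_1_le by (auto intro: mult_left_mono)
      show "\<bar>2 * \<alpha> y * \<beta> y\<bar> \<le> (\<alpha> y)\<^sup>2 + (\<beta> y)\<^sup>2"
        using sum_squares_bound[of "\<bar>\<alpha> y\<bar>" "\<bar>\<beta> y\<bar>"] by (simp add: abs_mult)
    qed (use w M_ge_1 in auto)
    finally show "w * (q y - 1) * (2 * \<alpha> y * \<beta> y) \<le> w * M * ((\<alpha> y)\<^sup>2 + (\<beta> y)\<^sup>2)" .
  qed
  moreover have "\<alpha> 0 = 0" "\<beta> 0 = 0" using init by (simp_all add: \<alpha>_def \<beta>_def)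
  ultimately have "(\<alpha> x)\<^sup>2 + (\<beta> x)\<^sup>2 \<le> 0" by simp
  then have "\<alpha> x = 0" "\<beta> x = 0" by (simp_all add: sum_power2_le_zero_iff)
  then show "\<phi> x = pressure_mode w x" "\<psi> x = velocity_mode w x"
    by (simp_all add: \<alpha>_def \<beta>_def)
qed

section \<open>Symmetries\<close>

lemma isCont_reflect:
  assumes sym: "\<And>x. q (a - x) = q x" and "isCont q x"
  shows "isCont q (a - x)"
proof -
  have "isCont (\<lambda>y. q (a - y)) (a - x)"
    by (rule isCont_o2[where g = q]) (use assms in auto)
  then show ?thesis by (simp add: sym)
qed

text \<open>
  The rate depends on the angle only through \<open>cos\<^sup>2\<close>, so \<open>k \<pi> - \<theta> (a - x)\<close> solves the same
  equation as \<open>\<theta>\<close> when \<open>q\<close> is symmetric about \<open>a / 2\<close>. The two solutions agree at \<open>a / 2\<close> exactly if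
  the angle there is \<open>k \<pi> / 2\<close>. The cases of interest are \<open>a = 0\<close>, \<open>k = 0\<close> and \<open>a = 2 l\<close>.
\<close>
lemma angle_reflect:
  assumes sym: "\<And>x. q (a - x) = q x" and mid: "angle w (a / 2) = real k * (pi / 2)"
  shows "angle w (a - x) = real k * pi - angle w x"
proof -
  have "angle_solution w (\<lambda>x. real k * pi - angle w (a - x))"
    unfolding angle_solution_def
  proof (intro conjI allI impI)
    show "continuous_on UNIV (\<lambda>x. real k * pi - angle w (a - x))"
      by (intro continuous_intros continuous_on_compose2[OF angle_continuous[OF w, of UNIV]]) auto
    fix x assume x: "isCont q x"
    have "((\<lambda>x. a - x) has_real_derivative - 1) (at x)"
      by (auto intro!: derivative_eq_intros)
    from DERIV_chain2[OF angle_deriv[OF w isCont_reflect[OF sym x]] this]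
    have "((\<lambda>x. real k * pi - angle w (a - x)) has_real_derivative
        w * rate (a - x) (angle w (a - x))) (at x)"
      by (auto intro!: derivative_eq_intros)
    moreover have "rate (a - x) t = rate x (real k * pi - t)" for t
      by (cases "even k") (simp_all add: rate_alt sym cos_diff)
    ultimately show "((\<lambda>x. real k * pi - angle w (a - x)) has_real_derivative
        w * rate x (real k * pi - angle w (a - x))) (at x)" by simp
  qed
  from angle_solution_unique[OF angle_solution_angle[OF w] this w, of "a / 2" x]
  show ?thesis using mid by simp
qed

text \<open>
  Under the reflection \<open>cos \<theta> sin \<theta>\<close> changes its sign, so both sides have the same derivative; they
  agree at \<open>a / 2\<close>.
\<close>
lemma log_amplitude_reflect:
  assumes sym: "\<And>x. q (a - x) = q x" and mid: "angle w (a / 2) = real k * (pi / 2)"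
  shows "log_amplitude w (a - x) = log_amplitude w x"
proof -
  let ?E = "\<lambda>x. (log_amplitude w (a - x) - log_amplitude w x)\<^sup>2"
  have "?E x = 0"
  proof (rule vanishes_if_vanishes_at_point[where E = ?E and a = "a / 2" and E' = "\<lambda>x. 0" and K = 0,
        OF finite_jumps'])
    show "continuous_on UNIV ?E"
      by (intro continuous_intros log_amplitude_continuous
            continuous_on_compose2[OF log_amplitude_continuous]) auto
    fix y assume "y \<notin> {x. \<not> isCont q x}"
    then have y: "isCont q y" by simp
    have "((\<lambda>x. a - x) has_real_derivative - 1) (at y)"
      by (auto intro!: derivative_eq_intros)
    note d = DERIV_chain2[OF log_amplitude_deriv[OF isCont_reflect[OF sym y]] this]
    have "cos (angle w (a - y)) * sin (angle w (a - y)) = - (cos (angle w y) * sin (angle w y))"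
      unfolding angle_reflect[OF assms] by (simp add: cos_diff sin_diff)
    then have "w * (q (a - y) - 1) * cos (angle w (a - y)) * sin (angle w (a - y)) * - 1
        = w * (q y - 1) * cos (angle w y) * sin (angle w y)"
      by (simp add: sym mult.assoc)
    with DERIV_diff[OF d log_amplitude_deriv[OF y]]
    have "((\<lambda>x. log_amplitude w (a - x) - log_amplitude w x) has_real_derivative 0) (at y)"
      by simp
    from DERIV_power[OF this, of 2] show "(?E has_real_derivative 0) (at y)" by simp
  qed auto
  then show ?thesis by simp
qed

text \<open>
  Two reflections make a translation: composing those in \<open>0\<close> and in \<open>l\<close> shifts \<open>x\<close> by \<open>2 l\<close> and the
  angle by \<open>k \<pi>\<close>. For odd \<open>k\<close> this changes the sign of the modes, and only the square of the
  translation is a period.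
\<close>
lemma modes_periodic:
  assumes even: "\<And>x. q (- x) = q x" and sym: "\<And>x. q (2 * l - x) = q x"
    and mid: "angle w l = real k * (pi / 2)"
  shows "pressure_mode w (x + 4 * l) = pressure_mode w x"
    and "velocity_mode w (x + 4 * l) = velocity_mode w x"
proof -
  have odd_angle: "angle w (- x) = - angle w x" for x
    using angle_reflect[of 0 0 x] even w by simp
  have angle_shift: "angle w (x + 2 * l) = angle w x + real k * pi" for x
    using angle_reflect[of "2 * l" k "- x"] sym mid by (simp add: odd_angle add.commute)
  have even_amplitude: "log_amplitude w (- x) = log_amplitude w x" for x
    using log_amplitude_reflect[of 0 0 x] even w by simp
  have amplitude_shift: "log_amplitude w (x + 2 * l) = log_amplitude w x" for x
    using log_amplitude_reflect[of "2 * l" k "- x"] sym mid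
    by (simp add: even_amplitude add.commute)
  have x: "x + 4 * l = (x + 2 * l) + 2 * l" by simp
  have "angle w (x + 4 * l) = angle w x + 2 * real k * pi"
    unfolding x angle_shift by simp
  moreover have "log_amplitude w (x + 4 * l) = log_amplitude w x"
    unfolding x amplitude_shift ..
  moreover have "cos (t + 2 * real k * pi) = cos t" "sin (t + 2 * real k * pi) = sin t" for t
    by (simp_all only: cos_add sin_add cos_2npi sin_2npi)
  ultimately show "pressure_mode w (x + 4 * l) = pressure_mode w x"
    and "velocity_mode w (x + 4 * l) = velocity_mode w x"
    by (simp_all add: pressure_mode_def velocity_mode_def)
qed

end

section \<open>Eigenfrequencies\<close>

lemma angle_zero_frequency: "angle 0 x = 0"
proof (rule angle_solution_unique[where w = 0 and \<theta> = "angle 0" and \<eta> = "\<lambda>x. 0" and a = 0])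
  show "angle_solution 0 (\<lambda>x. 0)" by (simp add: angle_solution_def)
qed (simp_all add: angle_solution_angle)

definition frequency :: "real \<Rightarrow> nat \<Rightarrow> real" where
  "frequency l k = (SOME w. 0 \<le> w \<and> angle w l = real k * (pi / 2))"

context
  fixes l :: real
  assumes l: "0 < l"
begin

lemma angle_less_iff:
  assumes "0 \<le> w1" "0 \<le> w2"
  shows "angle w1 l < angle w2 l \<longleftrightarrow> w1 < w2"
  using angle_strict_mono[OF assms(1) _ l, of w2] angle_strict_mono[OF assms(2) _ l, of w1]
  by (cases w1 w2 rule: linorder_cases) auto

text \<open>
  By \<open>angle_ge_linear\<close>, the angle at \<open>l\<close> has passed the value \<open>y\<close> at the frequency \<open>y / (c l)\<close>;
  the intermediate value theorem does the rest.
\<close>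
lemma frequency:
  shows frequency_nonneg: "0 \<le> frequency l k"
    and angle_frequency: "angle (frequency l k) l = real k * (pi / 2)"
proof -
  let ?y = "real k * (pi / 2)"
  have "\<exists>w\<ge>0. w \<le> ?y / (c * l) \<and> angle w l = ?y"
  proof (rule IVT')
    show "angle 0 l \<le> ?y" by (simp add: angle_zero_frequency)
    show "?y \<le> angle (?y / (c * l)) l"
      using angle_ge_linear[of "?y / (c * l)" l] l c_pos by simp
    show "0 \<le> ?y / (c * l)" using l c_pos by simp
    show "continuous_on {0..?y / (c * l)} (\<lambda>w. angle w l)"
      using l by (intro continuous_on_subset[OF angle_continuous_in_frequency]) auto
  qed
  then have "\<exists>w. 0 \<le> w \<and> angle w l = ?y" by blast
  from someI_ex[OF this] show "0 \<le> frequency l k" "angle (frequency l k) l = ?y"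
    by (simp_all add: frequency_def)
qed

lemma frequency_less: "k < m \<Longrightarrow> frequency l k < frequency l m"
  by (simp add: angle_frequency flip: angle_less_iff[OF frequency_nonneg frequency_nonneg])

lemma frequency_pos: "1 \<le> k \<Longrightarrow> 0 < frequency l k"
  using frequency_less[of 0 k] frequency_nonneg[of 0] by simp

lemma mode_zero_at_frequency:
  "if odd k then pressure_mode (frequency l k) l = 0 else velocity_mode (frequency l k) l = 0"
  using cos_zero_iff[of "real k * (pi / 2)"] sin_zero_iff[of "real k * (pi / 2)"]
  by (auto simp: pressure_mode_def velocity_mode_def angle_frequency)

text \<open>
  A zero of either mode means that the angle is a multiple of \<open>\<pi> / 2\<close>, and the angle determines the
  frequency.
\<close>
lemma frequency_if_mode_zero:
  assumes w: "0 < w" and zero: "pressure_mode w l = 0 \<or> velocity_mode w l = 0"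
  obtains k where "1 \<le> k" "w = frequency l k"
proof -
  have pos: "0 < angle w l"
    using angle_strict_mono[of 0 w l] w l by (simp add: angle_zero_frequency)
  have "\<exists>k::nat. angle w l = real k * (pi / 2)"
  proof (cases "cos (angle w l) = 0")
    case True
    then show ?thesis using pos unfolding cos_zero_iff
      by (metis less_le_not_le mult_nonneg_nonneg neg_0_less_iff_less of_nat_0_le_iff pi_half_ge_zero)
  next
    case False
    then have "sin (angle w l) = 0"
      using zero by (simp add: pressure_mode_def velocity_mode_def)
    then show ?thesis using pos unfolding sin_zero_iff
      by (metis less_le_not_le mult_nonneg_nonneg neg_0_less_iff_less of_nat_0_le_iff pi_half_ge_zero)
  qed
  then obtain k :: nat where k: "angle w l = real k * (pi / 2)" by blast
  show thesis
  proof
    show "1 \<le> k" using k pos by (cases k) auto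
    show "w = frequency l k"
      using angle_less_iff[of w "frequency l k"] angle_less_iff[of "frequency l k" w] w
      by (simp add: frequency_nonneg angle_frequency k)
  qed
qed

end

end

section \<open>The coefficient of an entropy profile\<close>

text \<open>
  Folding the line onto \<open>[0, l]\<close> takes \<open>x\<close> to its distance from the lattice of multiples of
  \<open>2 l\<close>. The extended coefficient is the given one composed with this map, so its continuity, bounds
  and symmetries follow from properties of the given coefficient on \<open>[0, l]\<close> and of this map.
\<close>
definition fold_interval :: "real \<Rightarrow> real \<Rightarrow> real" where
  "fold_interval l = even_periodic_ext l (\<lambda>x. x)"

lemma sigma_coeff_ext:
  "sigma_coeff v pbar (even_periodic_ext l s) x = sigma_coeff v pbar s (fold_interval l x)"
  by (simp add: sigma_coeff_def even_periodic_ext_def fold_interval_def)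

context
  fixes l :: real
  assumes l: "0 < l"
begin

lemma fold_interval_le_dist: "fold_interval l x \<le> \<bar>x - 2 * l * of_int n\<bar>"
proof -
  have scale: "\<bar>x - 2 * l * of_int m\<bar> = 2 * l * \<bar>x / (2 * l) - of_int m\<bar>" for m
  proof -
    have "x - 2 * l * of_int m = 2 * l * (x / (2 * l) - of_int m)"
      using l by (simp add: right_diff_distrib)
    then show ?thesis using l by (simp add: abs_mult)
  qed
  show ?thesis
    unfolding fold_interval_def even_periodic_ext_def scale
    using l by (intro mult_left_mono round_diff_minimal) auto
qed

lemma fold_interval_mem: "fold_interval l x \<in> {0..l}"
proof -
  define y where "y = x / (2 * l)"
  have x: "x = 2 * l * y" using l by (simp add: y_def)
  have "fold_interval l x = 2 * l * \<bar>y - of_int (round y)\<bar>"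
    using l by (simp add: fold_interval_def even_periodic_ext_def x abs_mult flip: right_diff_distrib)
  moreover have "2 * l * \<bar>y - of_int (round y)\<bar> \<le> 2 * l * (1 / 2)"
    using l of_int_round_abs_le[of y]
    by (intro mult_left_mono) (auto simp: abs_minus_commute)
  ultimately show ?thesis using l by simp
qed

text \<open>
  A distance function is Lipschitz with constant \<open>1\<close>.
\<close>
lemma fold_interval_isCont: "isCont (fold_interval l) x"
proof -
  have le: "fold_interval l y \<le> fold_interval l z + \<bar>y - z\<bar>" for y z
  proof -
    obtain n :: int where "fold_interval l z = \<bar>z - 2 * l * of_int n\<bar>"
      by (auto simp: fold_interval_def even_periodic_ext_def)
    then show ?thesis using fold_interval_le_dist[of y n] by linarith
  qed
  have "((\<lambda>y. fold_interval l y - fold_interval l x) \<longlongrightarrow> 0) (at x)"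
  proof (rule Lim_null_comparison)
    have "norm (fold_interval l y - fold_interval l x) \<le> \<bar>y - x\<bar>" for y
      using le[of x y] le[of y x] by (simp add: abs_le_iff abs_minus_commute)
    then show "\<forall>\<^sub>F y in at x. norm (fold_interval l y - fold_interval l x) \<le> \<bar>y - x\<bar>"
      by simp
    show "((\<lambda>y. \<bar>y - x\<bar>) \<longlongrightarrow> 0) (at x)" by (auto intro!: tendsto_eq_intros)
  qed
  then show ?thesis by (simp add: isCont_def LIM_zero_iff)
qed

lemma fold_interval_eq: "x \<in> {0..l} \<Longrightarrow> fold_interval l x = x"
  by (simp add: fold_interval_def even_periodic_ext_eq l)

lemma fold_interval_even: "fold_interval l (- x) = fold_interval l x"
  by (simp add: fold_interval_def even_periodic_ext_even l)

lemma fold_interval_reflect: "fold_interval l (2 * l - x) = fold_interval l x"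
  using even_periodic_ext_periodic[OF l, of _ "- x"] fold_interval_even[of x]
  by (simp add: fold_interval_def add.commute)

text \<open>
  A point \<open>x\<close> with folded value in \<open>N\<close> is \<open>2 l n \<plusminus> y\<close> with \<open>y \<in> N\<close>, and \<open>x \<in> [a, b]\<close>
  leaves finitely many \<open>n\<close>.
\<close>
lemma finite_fold_interval_preimage:
  assumes "finite N"
  shows "finite {x \<in> {a..b}. fold_interval l x \<in> N}"
proof -
  let ?I = "{\<lceil>(a - l) / (2 * l)\<rceil>..\<lfloor>(b + l) / (2 * l)\<rfloor>}"
  have "{x \<in> {a..b}. fold_interval l x \<in> N}
      \<subseteq> (\<lambda>(y, n). 2 * l * of_int n + y) ` ((N \<union> uminus ` N) \<times> ?I)"
  proof
    fix x assume x: "x \<in> {x \<in> {a..b}. fold_interval l x \<in> N}"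
    define n where "n = round (x / (2 * l))"
    define y where "y = x - 2 * l * of_int n"
    have y: "\<bar>y\<bar> = fold_interval l x"
      by (simp add: y_def n_def fold_interval_def even_periodic_ext_def)
    then have "y = fold_interval l x \<or> y = - fold_interval l x" by linarith
    then have "y \<in> N \<union> uminus ` N" using x by auto
    moreover have "\<bar>y\<bar> \<le> l" using y fold_interval_mem[of x] by simp
    then have "n \<in> ?I"
      using x l by (auto simp: y_def ceiling_le_iff le_floor_iff field_simps abs_le_iff)
    ultimately show "x \<in> (\<lambda>(y, n). 2 * l * of_int n + y) ` ((N \<union> uminus ` N) \<times> ?I)"
      by (intro image_eqI[of _ _ "(y, n)"]) (auto simp: y_def)
  qed
  then show ?thesis by (rule finite_subset) (use assms in auto)
qed

lemma isCont_sigma_ext: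
  assumes "continuous (at (fold_interval l x) within {0..l}) (sigma_coeff v pbar s)"
  shows "isCont (sigma_coeff v pbar (even_periodic_ext l s)) x"
proof -
  have "range (fold_interval l) \<subseteq> {0..l}" using fold_interval_mem by blast
  with assms have "continuous (at (fold_interval l x) within range (fold_interval l))
      (sigma_coeff v pbar s)"
    by (rule continuous_within_subset)
  from continuous_within_compose[OF fold_interval_isCont this] show ?thesis
    by (simp add: comp_def flip: sigma_coeff_ext)
qed

lemma sigma_continuous_within:
  assumes "isCont (sigma_coeff v pbar (even_periodic_ext l s)) x" "x \<in> {0..l}"
  shows "continuous (at x within {0..l}) (sigma_coeff v pbar s)"
proof -
  have "continuous (at x within {0..l}) (sigma_coeff v pbar (even_periodic_ext l s))"
    using assms(1) by (rule continuous_at_imp_continuous_at_within)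
  then show ?thesis
    by (rule continuous_transform_within[where \<delta> = 1])
       (use assms(2) in \<open>auto simp: sigma_coeff_ext fold_interval_eq\<close>)
qed

end

text \<open>
  At fixed pressure, \<open>v\<^sub>p\<close> is the partial derivative \<open>D 1 0\<close> supplied by smoothness, and
  that is itself differentiable.
\<close>
lemma continuous_on_d_pressure:
  assumes "pbar > 0" "constitutive v"
  shows "continuous_on UNIV (d_pressure v pbar)"
proof -
  obtain D where D0: "\<forall>(a, b) \<in> {0<..} \<times> UNIV. D 0 0 (a, b) = v a b"
    and D: "\<forall>i j. \<forall>z \<in> {0<..} \<times> UNIV.
      (D i j has_derivative (\<lambda>(h, k). D (Suc i) j z * h + D i (Suc j) z * k)) (at z)"
    using assms(2) unfolding constitutive_def smooth_two_on_def by (elim conjE exE)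
  have "d_pressure v pbar b = D 1 0 (pbar, b)" for b
  proof -
    have "((\<lambda>q. (q, b)) has_derivative (\<lambda>h. (h, 0))) (at pbar)"
      by (auto intro!: derivative_eq_intros)
    from has_derivative_compose[OF this D[rule_format, of "(pbar, b)" 0 0]]
    have "((\<lambda>q. D 0 0 (q, b)) has_real_derivative D 1 0 (pbar, b)) (at pbar)"
      using assms(1) by (simp add: has_field_derivative_def)
    then have "((\<lambda>q. v q b) has_real_derivative D 1 0 (pbar, b)) (at pbar)"
      by (rule has_field_derivative_transform_within_open[where S = "{0<..}"])
         (use assms(1) D0 in auto)
    then show ?thesis by (simp add: d_pressure_def DERIV_imp_deriv)
  qed
  moreover have "isCont (\<lambda>b. D 1 0 (pbar, b)) b" for b
    using has_derivative_continuous[OF D[rule_format, of "(pbar, b)" 1 0]] assms(1)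
    by (intro isCont_o2[where g = "D 1 0" and f = "\<lambda>b. (pbar, b)"] continuous_intros) simp
  ultimately show ?thesis
    by (simp add: continuous_at_imp_continuous_on)
qed

lemma sigma_squared:
  assumes "pbar > 0" "constitutive v"
  shows "(sigma_coeff v pbar s x)\<^sup>2 = - d_pressure v pbar (s x)"
  using assms by (simp add: sigma_coeff_def constitutive_def less_imp_le)

text \<open>
  The entropy takes its values in a compact interval, on which the continuous positive function
  \<open>- v\<^sub>p\<close> attains its extrema.
\<close>
lemma sigma_squared_bounds:
  assumes "pbar > 0" "constitutive v" "bounded (s ` {0..l})"
  obtains c M where "0 < c" "c \<le> 1" "1 \<le> M"
    "\<And>x. x \<in> {0..l} \<Longrightarrow> c \<le> (sigma_coeff v pbar s x)\<^sup>2"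
    "\<And>x. x \<in> {0..l} \<Longrightarrow> (sigma_coeff v pbar s x)\<^sup>2 \<le> M"
proof -
  obtain B where "\<forall>y \<in> s ` {0..l}. norm y \<le> B"
    using assms(3) unfolding bounded_iff by blast
  then have B: "\<bar>s x\<bar> \<le> B" if "x \<in> {0..l}" for x using that by auto
  define K where "K = {- \<bar>B\<bar>..\<bar>B\<bar>}"
  have K: "compact K" "K \<noteq> {}" by (auto simp: K_def)
  have cont: "continuous_on K (\<lambda>b. - d_pressure v pbar b)"
    using continuous_on_d_pressure[OF assms(1,2)]
    by (intro continuous_intros) (auto intro: continuous_on_subset)
  obtain b1 where b1: "\<And>b. b \<in> K \<Longrightarrow> - d_pressure v pbar b1 \<le> - d_pressure v pbar b"
    using continuous_attains_inf[OF K cont] by blast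
  obtain b2 where b2: "\<And>b. b \<in> K \<Longrightarrow> - d_pressure v pbar b \<le> - d_pressure v pbar b2"
    using continuous_attains_sup[OF K cont] by blast
  have mem: "s x \<in> K" if "x \<in> {0..l}" for x
    using B[OF that] by (auto simp: K_def abs_le_iff)
  show thesis
  proof
    show "0 < min 1 (- d_pressure v pbar b1)"
      using assms(1,2) by (simp add: constitutive_def)
    show "min 1 (- d_pressure v pbar b1) \<le> (sigma_coeff v pbar s x)\<^sup>2" if "x \<in> {0..l}" for x
      using b1[OF mem[OF that]] by (simp add: sigma_squared[OF assms(1,2)] min.coboundedI2)
    show "(sigma_coeff v pbar s x)\<^sup>2 \<le> max 1 (- d_pressure v pbar b2)" if "x \<in> {0..l}" for x
      using b2[OF mem[OF that]] by (simp add: sigma_squared[OF assms(1,2)] max.coboundedI2)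
  qed auto
qed

lemma bounded_coefficient_sigma_ext:
  assumes "l > 0" "pbar > 0" "constitutive v" "entropy_profile l s"
  obtains c M where
    "bounded_coefficient (\<lambda>x. (sigma_coeff v pbar (even_periodic_ext l s) x)\<^sup>2) c M"
proof -
  define \<tau> where "\<tau> = sigma_coeff v pbar (even_periodic_ext l s)"
  have "bounded (s ` {0..l})" using assms(4) by (simp add: entropy_profile_def)
  from sigma_squared_bounds[OF assms(2,3) this] obtain c M where cM: "0 < c" "c \<le> 1" "1 \<le> M"
    "\<And>x. x \<in> {0..l} \<Longrightarrow> c \<le> (sigma_coeff v pbar s x)\<^sup>2"
    "\<And>x. x \<in> {0..l} \<Longrightarrow> (sigma_coeff v pbar s x)\<^sup>2 \<le> M"
    by blast
  have "bounded_coefficient (\<lambda>x. (\<tau> x)\<^sup>2) c M"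
  proof
    show "c \<le> (\<tau> x)\<^sup>2" "(\<tau> x)\<^sup>2 \<le> M" for x
      using cM(4,5) fold_interval_mem[OF assms(1)] by (auto simp: \<tau>_def sigma_coeff_ext)
    fix a b :: real
    define N where "N = {x \<in> {0..l}. \<not> continuous (at x within {0..l}) (sigma_coeff v pbar s)}"
    have N: "finite N"
      unfolding N_def by (rule finite_discontinuities_sigma[OF assms(2-4)])
    have "fold_interval l x \<in> N" if "\<not> isCont (\<lambda>x. (\<tau> x)\<^sup>2) x" for x
    proof (rule ccontr)
      assume "fold_interval l x \<notin> N"
      then have "isCont \<tau> x"
        unfolding \<tau>_def using fold_interval_mem[OF assms(1), of x]
        by (intro isCont_sigma_ext[OF assms(1)]) (auto simp: N_def)
      then have "isCont (\<lambda>x. (\<tau> x)\<^sup>2) x" by (intro continuous_intros)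
      then show False using that by simp
    qed
    then show "finite {x \<in> {a..b}. \<not> isCont (\<lambda>x. (\<tau> x)\<^sup>2) x}"
      by (intro finite_subset[OF _ finite_fold_interval_preimage[OF assms(1) N, of a b]]) auto
  qed (use cM in auto)
  then show thesis using that by (simp add: \<tau>_def)
qed

section \<open>Separated solutions of the linearized system\<close>

lemma linear_solution_modes:
  assumes "sl_solution S \<sigma> w \<phi> \<psi>"
  shows "linear_solution S \<sigma> (mode_P w \<phi>) (mode_U w \<psi>)"
  unfolding linear_solution_def
proof (intro conjI ballI allI impI)
  have cont: "continuous_on S \<phi>" "continuous_on S \<psi>"
    using assms by (auto simp: sl_solution_def)
  have "continuous_on (S \<times> UNIV) (\<lambda>z. cos (w * snd z) * \<phi> (fst z))"
    by (intro continuous_intros continuous_on_compose2[OF cont(1)]) auto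
  then show "continuous_on (S \<times> UNIV) (\<lambda>(x, t). mode_P w \<phi> x t)"
    by (simp add: mode_P_def case_prod_unfold)
  have "continuous_on (S \<times> UNIV) (\<lambda>z. sin (w * snd z) * \<psi> (fst z))"
    by (intro continuous_intros continuous_on_compose2[OF cont(2)]) auto
  then show "continuous_on (S \<times> UNIV) (\<lambda>(x, t). mode_U w \<psi> x t)"
    by (simp add: mode_U_def case_prod_unfold)
  fix x t assume "x \<in> S" "continuous (at x within S) \<sigma>"
  then obtain \<phi>' \<psi>' where d: "(\<phi> has_real_derivative \<phi>') (at x within S)"
    "(\<psi> has_real_derivative \<psi>') (at x within S)"
    and eq: "\<phi>' + w * \<psi> x = 0" "\<psi>' - (\<sigma> x)\<^sup>2 * w * \<phi> x = 0"
    using assms by (auto simp: sl_solution_def)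
  have "((\<lambda>y. mode_P w \<phi> y t) has_real_derivative cos (w * t) * \<phi>') (at x within S)"
    "((\<lambda>r. mode_P w \<phi> x r) has_real_derivative - (w * sin (w * t)) * \<phi> x) (at t)"
    "((\<lambda>y. mode_U w \<psi> y t) has_real_derivative sin (w * t) * \<psi>') (at x within S)"
    "((\<lambda>r. mode_U w \<psi> x r) has_real_derivative w * cos (w * t) * \<psi> x) (at t)"
    unfolding mode_P_def mode_U_def by (auto intro!: derivative_eq_intros d)
  moreover have "cos (w * t) * \<phi>' + w * cos (w * t) * \<psi> x = cos (w * t) * (\<phi>' + w * \<psi> x)"
    by (simp add: algebra_simps)
  moreover have "sin (w * t) * \<psi>' + (\<sigma> x)\<^sup>2 * (- (w * sin (w * t)) * \<phi> x)
      = sin (w * t) * (\<psi>' - (\<sigma> x)\<^sup>2 * w * \<phi> x)"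
    by (simp add: algebra_simps)
  ultimately show "\<exists>Px Pt Ux Ut.
     ((\<lambda>y. mode_P w \<phi> y t) has_real_derivative Px) (at x within S) \<and>
     ((\<lambda>r. mode_P w \<phi> x r) has_real_derivative Pt) (at t) \<and>
     ((\<lambda>y. mode_U w \<psi> y t) has_real_derivative Ux) (at x within S) \<and>
     ((\<lambda>r. mode_U w \<psi> x r) has_real_derivative Ut) (at t) \<and>
     Px + Ut = 0 \<and> Ux + (\<sigma> x)\<^sup>2 * Pt = 0"
    using eq by (metis mult_zero_right)
qed

lemma
  assumes "0 < w"
  shows mode_P_time_periodic: "mode_P w \<phi> x (t + 2 * pi * real k / w) = mode_P w \<phi> x t"
    and mode_U_time_periodic: "mode_U w \<psi> x (t + 2 * pi * real k / w) = mode_U w \<psi> x t"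
proof -
  have "w * (t + 2 * pi * real k / w) = w * t + 2 * real k * pi"
    using assms by (simp add: field_simps)
  then show "mode_P w \<phi> x (t + 2 * pi * real k / w) = mode_P w \<phi> x t"
    "mode_U w \<psi> x (t + 2 * pi * real k / w) = mode_U w \<psi> x t"
    unfolding mode_P_def mode_U_def by (simp_all only: cos_add sin_add cos_2npi sin_2npi) simp_all
qed

text \<open>
  The condition at \<open>x = l\<close> asks that the trace be even about the time \<open>T / 4\<close>, at which the phase is
  \<open>k \<pi> / 2\<close>. For odd \<open>k\<close> only the sine remains and the phase is one of its extrema; for even \<open>k\<close>
  only the cosine remains and the same is true of it.
\<close>
lemma boundary_conditions_modes:
  assumes w: "0 < w" and "\<psi> 0 = 0" and zero: "if odd k then \<phi> l = 0 else \<psi> l = 0"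
  shows "boundary_conditions l (2 * pi * real k / w) (mode_P w \<phi>) (mode_U w \<psi>)"
  unfolding boundary_conditions_def
proof (intro conjI ballI)
  let ?T = "2 * pi * real k / w"
  fix x
  show "mode_U w \<psi> x 0 = mode_U w \<psi> x ?T" "mode_P w \<phi> x 0 = mode_P w \<phi> x ?T"
    using mode_U_time_periodic[OF w, of \<psi> x 0 k] mode_P_time_periodic[OF w, of \<phi> x 0 k]
    by simp_all
next
  let ?T = "2 * pi * real k / w"
  fix t
  show "mode_U w \<psi> 0 t = 0" using assms by (simp add: mode_U_def)
  have "w * (t + ?T / 4) = real k * (pi / 2) + w * t"
    "w * (- t + ?T / 4) = real k * (pi / 2) - w * t"
    using w by (simp_all add: field_simps)
  moreover have "cos (real k * (pi / 2)) = 0" if "odd k"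
    using that by (auto simp: cos_zero_iff)
  moreover have "sin (real k * (pi / 2)) = 0" if "even k"
    using that by (auto simp: sin_zero_iff)
  ultimately show "odd_part (translate (- ?T / 4) (\<lambda>r. mode_P w \<phi> l r + mode_U w \<psi> l r)) t = 0"
    using zero
    by (auto simp: odd_part_def reflect_def translate_def mode_P_def mode_U_def
        cos_add cos_diff sin_add sin_diff split: if_splits)
qed

theorem theorem1p3:
  fixes l pbar :: real and v :: "real \<Rightarrow> real \<Rightarrow> real" and s :: "real \<Rightarrow> real"
  assumes "l > 0" and "pbar > 0" and "constitutive v" and "entropy_profile l s"
  shows "\<exists>\<omega>. eigenfrequencies l (sigma_coeff v pbar s) \<omega> \<and>
    (\<forall>k \<ge> 1. \<exists>\<phi> \<psi>.
       sl_normalized l (sigma_coeff v pbar s) (\<omega> k) \<phi> \<psi> \<and>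
       (if odd k then \<phi> l = 0 else \<psi> l = 0) \<and>
       linear_solution {0..l} (sigma_coeff v pbar s) (mode_P (\<omega> k) \<phi>) (mode_U (\<omega> k) \<psi>) \<and>
       boundary_conditions l (2 * pi * real k / \<omega> k) (mode_P (\<omega> k) \<phi>) (mode_U (\<omega> k) \<psi>) \<and>
       (\<exists>\<Phi> \<Psi>.
          (\<forall>x \<in> {0..l}. \<Phi> x = \<phi> x \<and> \<Psi> x = \<psi> x) \<and>
          sl_solution UNIV (sigma_coeff v pbar (even_periodic_ext l s)) (\<omega> k) \<Phi> \<Psi> \<and>
          linear_solution UNIV (sigma_coeff v pbar (even_periodic_ext l s))
            (mode_P (\<omega> k) \<Phi>) (mode_U (\<omega> k) \<Psi>) \<and>
          jointly_periodic (4 * l) (2 * pi * real k / \<omega> k) (mode_P (\<omega> k) \<Phi>) \<and>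
          jointly_periodic (4 * l) (2 * pi * real k / \<omega> k) (mode_U (\<omega> k) \<Psi>)))"
proof -
  define \<sigma> where "\<sigma> = sigma_coeff v pbar s"
  define \<tau> where "\<tau> = sigma_coeff v pbar (even_periodic_ext l s)"
  obtain c M where "bounded_coefficient (\<lambda>x. (\<tau> x)\<^sup>2) c M"
    unfolding \<tau>_def by (rule bounded_coefficient_sigma_ext[OF assms])
  then interpret bounded_coefficient "\<lambda>x. (\<tau> x)\<^sup>2" c M .

  have \<tau>_nonneg: "0 \<le> \<tau> x" for x
    using assms by (simp add: \<tau>_def sigma_coeff_def constitutive_def less_imp_le)
  have \<tau>_eq: "\<tau> x = \<sigma> x" if "x \<in> {0..l}" for x
    using that by (simp add: \<sigma>_def \<tau>_def sigma_coeff_ext fold_interval_eq[OF assms(1)])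
  \<comment> \<open>The solutions on \<open>[0, l]\<close> refer to one-sided continuity of \<open>\<sigma>\<close>, those on the line to
    continuity of \<open>\<tau>\<close>; by the even reflections at the end points the two notions agree on \<open>[0, l]\<close>.\<close>
  have \<tau>_isCont: "isCont \<tau> x" if "continuous (at x within {0..l}) \<sigma>" "x \<in> {0..l}" for x
    unfolding \<tau>_def by (rule isCont_sigma_ext[OF assms(1)])
      (use that in \<open>simp add: \<sigma>_def fold_interval_eq[OF assms(1)]\<close>)
  have square_isCont: "isCont (\<lambda>x. (\<tau> x)\<^sup>2) x" if "isCont \<tau> x" for x
    using that by (intro continuous_intros)
  have \<sigma>_continuous: "continuous (at x within {0..l}) \<sigma>"
    if "isCont (\<lambda>x. (\<tau> x)\<^sup>2) x" "x \<in> {0..l}" for x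
  proof -
    \<comment> \<open>Continuity is known of \<open>\<tau>\<^sup>2\<close> only; as \<open>\<tau> \<ge> 0\<close>, it passes to the square root.\<close>
    have "isCont (\<lambda>x. sqrt ((\<tau> x)\<^sup>2)) x" using that(1) by (rule continuous_real_sqrt)
    moreover have "(\<lambda>x. sqrt ((\<tau> x)\<^sup>2)) = \<tau>" by (simp add: \<tau>_nonneg)
    ultimately have "isCont \<tau> x" by metis
    then show ?thesis
      using sigma_continuous_within[OF assms(1)] that(2) by (simp add: \<sigma>_def \<tau>_def)
  qed

  have solution_UNIV: "sl_solution UNIV \<tau> w (pressure_mode w) (velocity_mode w)" if "0 \<le> w" for w
    unfolding sl_solution_def
    using pressure_mode_deriv[OF that square_isCont] velocity_mode_deriv[OF that square_isCont]
    by (fastforce intro: pressure_mode_continuous velocity_mode_continuous that)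
  have normalized: "sl_normalized l \<sigma> w (pressure_mode w) (velocity_mode w)" if "0 \<le> w" for w
    unfolding sl_normalized_def sl_solution_def
  proof (intro conjI ballI impI)
    fix x assume x: "x \<in> {0..l}" "continuous (at x within {0..l}) \<sigma>"
    have cont: "isCont (\<lambda>x. (\<tau> x)\<^sup>2) x" using square_isCont \<tau>_isCont x by blast
    from pressure_mode_deriv[OF that cont] velocity_mode_deriv[OF that cont] \<tau>_eq[OF x(1)]
    show "\<exists>\<phi>' \<psi>'. (pressure_mode w has_real_derivative \<phi>') (at x within {0..l}) \<and>
        (velocity_mode w has_real_derivative \<psi>') (at x within {0..l}) \<and>
        \<phi>' + w * velocity_mode w x = 0 \<and> \<psi>' - (\<sigma> x)\<^sup>2 * w * pressure_mode w x = 0"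
      by (intro exI[of _ "- (w * velocity_mode w x)"] exI[of _ "(\<sigma> x)\<^sup>2 * w * pressure_mode w x"])
         (auto intro: has_field_derivative_at_within)
  qed (use that in \<open>auto intro: pressure_mode_continuous velocity_mode_continuous\<close>)
  have unique: "\<phi> l = pressure_mode w l \<and> \<psi> l = velocity_mode w l"
    if w: "0 \<le> w" and sol: "sl_normalized l \<sigma> w \<phi> \<psi>" for w \<phi> \<psi>
  proof -
    have deriv: "(\<phi> has_real_derivative - (w * \<psi> x)) (at x) \<and>
        (\<psi> has_real_derivative (\<tau> x)\<^sup>2 * w * \<phi> x) (at x)"
      if x: "x \<in> {0<..<l}" "isCont (\<lambda>x. (\<tau> x)\<^sup>2) x" for x
    proof -
      have "continuous (at x within {0..l}) \<sigma>" using \<sigma>_continuous x by simp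
      then obtain \<phi>' \<psi>' where d: "(\<phi> has_real_derivative \<phi>') (at x within {0..l})"
        "(\<psi> has_real_derivative \<psi>') (at x within {0..l})"
        and eq: "\<phi>' + w * \<psi> x = 0" "\<psi>' - (\<sigma> x)\<^sup>2 * w * \<phi> x = 0"
        using sol x(1) unfolding sl_normalized_def sl_solution_def by fastforce
      have "at x within {0..l} = at x" using x(1) by (intro at_within_interior) auto
      moreover have "\<phi>' = - (w * \<psi> x)" "\<psi>' = (\<tau> x)\<^sup>2 * w * \<phi> x"
        using eq \<tau>_eq[of x] x(1) by auto
      ultimately show ?thesis using d by simp
    qed
    have "continuous_on {0..l} \<phi>" "continuous_on {0..l} \<psi>" "\<phi> 0 = 1" "\<psi> 0 = 0"
      using sol by (auto simp: sl_normalized_def sl_solution_def)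
    from linear_system_unique[OF w this] deriv show ?thesis using assms(1) by auto
  qed

  define \<omega> where "\<omega> = frequency l"
  have \<omega>_pos: "0 < \<omega> k" if "1 \<le> k" for k
    unfolding \<omega>_def by (rule frequency_pos[OF assms(1) that])
  have zero: "if odd k then pressure_mode (\<omega> k) l = 0 else velocity_mode (\<omega> k) l = 0" for k
    unfolding \<omega>_def by (rule mode_zero_at_frequency[OF assms(1)])
  have "eigenfrequencies l \<sigma> \<omega>"
    unfolding eigenfrequencies_def
  proof (intro conjI allI impI)
    show "strict_mono_on {1..} \<omega>"
      by (rule strict_mono_onI) (simp add: \<omega>_def frequency_less[OF assms(1)])
    fix k :: nat assume k: "1 \<le> k"
    then show "0 < \<omega> k" by (rule \<omega>_pos)
    then show "\<exists>\<phi> \<psi>. sl_normalized l \<sigma> (\<omega> k) \<phi> \<psi> \<and> (if odd k then \<phi> l = 0 else \<psi> l = 0)"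
      using normalized[of "\<omega> k"] zero[of k] less_imp_le by blast
  next
    fix w :: real and \<phi> \<psi>
    assume w: "0 < w" and sol: "sl_normalized l \<sigma> w \<phi> \<psi> \<and> (\<phi> l = 0 \<or> \<psi> l = 0)"
    then have "pressure_mode w l = 0 \<or> velocity_mode w l = 0"
      using unique[of w \<phi> \<psi>] by auto
    from frequency_if_mode_zero[OF assms(1) w this]
    show "\<exists>k\<ge>1. w = \<omega> k" unfolding \<omega>_def by blast
  qed
  moreover have "\<exists>\<phi> \<psi>.
       sl_normalized l \<sigma> (\<omega> k) \<phi> \<psi> \<and>
       (if odd k then \<phi> l = 0 else \<psi> l = 0) \<and>
       linear_solution {0..l} \<sigma> (mode_P (\<omega> k) \<phi>) (mode_U (\<omega> k) \<psi>) \<and>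
       boundary_conditions l (2 * pi * real k / \<omega> k) (mode_P (\<omega> k) \<phi>) (mode_U (\<omega> k) \<psi>) \<and>
       (\<exists>\<Phi> \<Psi>.
          (\<forall>x \<in> {0..l}. \<Phi> x = \<phi> x \<and> \<Psi> x = \<psi> x) \<and>
          sl_solution UNIV \<tau> (\<omega> k) \<Phi> \<Psi> \<and>
          linear_solution UNIV \<tau> (mode_P (\<omega> k) \<Phi>) (mode_U (\<omega> k) \<Psi>) \<and>
          jointly_periodic (4 * l) (2 * pi * real k / \<omega> k) (mode_P (\<omega> k) \<Phi>) \<and>
          jointly_periodic (4 * l) (2 * pi * real k / \<omega> k) (mode_U (\<omega> k) \<Psi>))"
    if k: "1 \<le> k" for k
  proof -
    let ?\<phi> = "pressure_mode (\<omega> k)" and ?\<psi> = "velocity_mode (\<omega> k)"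
    have w: "0 < \<omega> k" "0 \<le> \<omega> k" using \<omega>_pos[OF k] by auto
    have "(\<tau> (- x))\<^sup>2 = (\<tau> x)\<^sup>2" "(\<tau> (2 * l - x))\<^sup>2 = (\<tau> x)\<^sup>2" for x
      by (simp_all add: \<tau>_def sigma_coeff_ext fold_interval_even fold_interval_reflect assms(1))
    then have "?\<phi> (x + 4 * l) = ?\<phi> x" "?\<psi> (x + 4 * l) = ?\<psi> x" for x
      using modes_periodic[OF w(2)] angle_frequency[OF assms(1)] by (auto simp: \<omega>_def)
    then have "jointly_periodic (4 * l) (2 * pi * real k / \<omega> k) (mode_P (\<omega> k) ?\<phi>)"
      "jointly_periodic (4 * l) (2 * pi * real k / \<omega> k) (mode_U (\<omega> k) ?\<psi>)"
      by (simp_all add: jointly_periodic_def mode_P_time_periodic mode_U_time_periodic w(1))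
         (simp_all add: mode_P_def mode_U_def)
    moreover have "linear_solution {0..l} \<sigma> (mode_P (\<omega> k) ?\<phi>) (mode_U (\<omega> k) ?\<psi>)"
      using normalized[OF w(2)] by (intro linear_solution_modes) (simp add: sl_normalized_def)
    moreover have "boundary_conditions l (2 * pi * real k / \<omega> k) (mode_P (\<omega> k) ?\<phi>) (mode_U (\<omega> k) ?\<psi>)"
      using zero[of k] w by (intro boundary_conditions_modes) auto
    ultimately show ?thesis
      using normalized[OF w(2)] zero[of k] solution_UNIV[OF w(2)]
        linear_solution_modes[OF solution_UNIV[OF w(2)]]
      by blast
  qed
  ultimately show ?thesis unfolding \<sigma>_def \<tau>_def by blast
qed

end
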